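(* Let $\rho=\frac{\lambda z_0}{\ell A}$ and suppose that $\frac2\rho\in\mathbb{N}$. Consider synthetic aperture imaging with the target vector $X$ randomly drawn from the target ensemble with sparsity $s\ge2$ and, independently, the antenna array randomly drawn from the sensor ensemble with $n$ sensor locations. Let $\epsilon\in(0,1)$ and suppose that $m\le\frac{\delta}{2}e^{K^2/2}$ for some $\delta>0$, $K>0$. If the sparsity $s$ is at most $$\frac{n}{64\,\ln\frac{2m}{\delta}\,\ln\frac m\epsilon},$$ then $X$ is recovered exactly by Basis Pursuit with the sensing matrix $\mathbf A^{\rm SA}$, with probability (over the product of the sensor and target ensembles) greater than or equal to $$\left[1-2\delta-\frac{\rho\,n(n-1)^{3/2}}{m^{1/2}}\right]\times\left[1-2\epsilon-s^{-p}\right],\qquad p=\frac{\ln m-\ln\epsilon}{288\sqrt e\,\ln s}.$$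
   Context: Fix real numbers $z_0,\ell,A,\lambda>0$ and set $\omega=2\pi/\lambda$. Let $m$ be a perfect square. Target grid: $\mathcal{M}=\{\mathbf r_j=(x_j,y_j,z_0): j=1,\dots,m\}$ is a $\sqrt m\times\sqrt m$ square lattice of mesh size $\ell$ in the plane $\{z=z_0\}$. Sensor ensemble: the sensor locations are $\mathbf a_q=(\xi_q,\eta_q,0)$, $q=1,\dots,n$, where $(\xi_q,\eta_q)$ are i.i.d. uniformly distributed in $[0,A]\times[0,A]$. Let $G(\mathbf r,\mathbf a)=\frac{e^{i\omega z_0}}{4\pi z_0}e^{i\omega|x-\xi|^2/(2z_0)}e^{i\omega|y-\eta|^2/(2z_0)}$ be the paraxial Green function for $\mathbf r=(x,y,z_0)$, $\mathbf a=(\xi,\eta,0)$. The synthetic aperture (SA) sensing matrix $\mathbf A^{\rm SA}$ (Born approximation) is the $n\times m$ matrix with entries $G^2(\mathbf a_q,\mathbf r_j)$, normalized so that columns have unit $\ell^2$-norm; i.e. up to a constant unimodular factor $$A^{\rm SA}_{qj}=\frac1{\sqrt n}\exp\!\Big(\tfrac{i\omega}{z_0}\big[(x_j-\xi_q)^2+(y_j-\eta_q)^2\big]\Big).$$ Target ensemble (sparsity $s$): random vectors $X\in\mathbb C^m$ with at most $s$ nonzero entries, whose support indices are independently and randomly (uniformly) selected from $\{1,\dots,m\}$ and whose nonzero entries have phases that are independent and uniformly distributed in $[0,2\pi]$ (the magnitudes are arbitrary). The target ensemble is independent of the sensor ensemble. Basis Pursuit (BP): given $Y=\mathbf A^{\rm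 SA}X$, solve $\min\|Z\|_1$ subject to $\mathbf A^{\rm SA}Z=Y$. "Recovered exactly by BP" means that $X$ is the unique minimizer.
   Formalization: Each of the two brackets in the probability bound is replaced by its positive part, since when both brackets are negative the printed product can exceed 1 (e.g. m=1, δ=1, ε=0.9, s=2, n=10, ρ=2). *)

theory Defs
  imports "HOL-Probability.Probability"
begin

text \<open>
  All targets lie in the plane \<open>z = z0\<close> and all sensors in the plane \<open>z = 0\<close>, so both are
  given by their transversal coordinates. Targets are indexed by a finite type of size \<open>m\<close>,
  sensors by a finite type of size \<open>n\<close>.
\<close>

definition square_lattice :: "real \<Rightarrow> real \<Rightarrow> real \<Rightarrow> nat \<Rightarrow> (real \<times> real) set" where
  "square_lattice x0 y0 l k = {(x0 + l * real a, y0 + l * real b) | a b. a < k \<and> b < k}"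

definition paraxial_green :: "real \<Rightarrow> real \<Rightarrow> real \<times> real \<Rightarrow> real \<times> real \<Rightarrow> complex" where
  "paraxial_green \<omega> z0 r a =
     exp (\<i> * of_real (\<omega> * z0)) / of_real (4 * pi * z0)
     * exp (\<i> * of_real (\<omega> * \<bar>fst r - fst a\<bar>\<^sup>2 / (2 * z0)))
     * exp (\<i> * of_real (\<omega> * \<bar>snd r - snd a\<bar>\<^sup>2 / (2 * z0)))"

definition normalize_columns :: "complex ^ 'm ^ 'n \<Rightarrow> complex ^ 'm ^ 'n" where
  "normalize_columns B = (\<chi> q j. B $ q $ j / of_real (norm (column j B)))"

definition SA_matrix ::
    "real \<Rightarrow> real \<Rightarrow> ('m \<Rightarrow> real \<times> real) \<Rightarrow> ('n \<Rightarrow> real \<times> real) \<Rightarrow> complex ^ 'm ^ 'n" where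
  "SA_matrix lam z0 pos a =
     normalize_columns (\<chi> q j. (paraxial_green (2 * pi / lam) z0 (pos j) (a q))\<^sup>2)"

definition sensor_ensemble :: "real \<Rightarrow> ('n \<Rightarrow> real \<times> real) measure" where
  "sensor_ensemble A = (\<Pi>\<^sub>M q\<in>UNIV. uniform_measure lborel ({0..A} \<times> {0..A}))"

definition support :: "complex ^ 'm \<Rightarrow> 'm set" where
  "support X = {j. X $ j \<noteq> 0}"

text \<open>
  The support consists of the outcomes of \<open>s\<close> independent uniform draws from the index set.
  Repetitions are possible, so it has at most \<open>s\<close> elements.
\<close>

definition support_law :: "nat \<Rightarrow> 'm::finite set pmf" where
  "support_law s = map_pmf set (replicate_pmf s (pmf_of_set UNIV))"

text \<open>
  \<open>T\<close> is the law of a random target vector. The second part prescribes the joint law of the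
  support and of the phases of the nonzero entries: given that the support is \<open>S\<close>, the phases
  of the entries in \<open>S\<close> are independent and uniform. The magnitudes are unconstrained; they may
  be random and depend on the support and on the phases.
\<close>

definition target_ensemble :: "nat \<Rightarrow> (complex ^ 'm::finite) measure \<Rightarrow> bool" where
  "target_ensemble s T \<longleftrightarrow>
     prob_space T \<and> sets T = sets borel \<and>
     (\<forall>S B. (\<forall>j\<in>S. B j \<in> sets borel) \<longrightarrow>
        measure T {X. support X = S \<and> (\<forall>j\<in>S. Arg2pi (X $ j) \<in> B j)} =
        pmf (support_law s) S * (\<Prod>j\<in>S. measure (uniform_measure lborel {0..2 * pi}) (B j)))"

definition l1_norm :: "complex ^ 'm \<Rightarrow> real" where
  "l1_norm Z = (\<Sum>j\<in>UNIV. norm (Z $ j))"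

definition BP_solutions :: "complex ^ 'm ^ 'n \<Rightarrow> complex ^ 'n \<Rightarrow> (complex ^ 'm) set" where
  "BP_solutions M Y = {Z. is_arg_min l1_norm (\<lambda>Z. M *v Z = Y) Z}"

definition BP_recovers :: "complex ^ 'm ^ 'n \<Rightarrow> complex ^ 'm \<Rightarrow> bool" where
  "BP_recovers M X \<longleftrightarrow> BP_solutions M (M *v X) = {X}"

lemma exp_i_eq_cis: "exp (\<i> * of_real t) = cis t"
  by (simp add: cis_conv_exp)

lemma SA_matrix_nth:
  fixes pos :: "'m::finite \<Rightarrow> real \<times> real" and a :: "'n::finite \<Rightarrow> real \<times> real"
  assumes "z0 > 0"
  shows "SA_matrix lam z0 pos a $ q $ j =
    cis (2 * (2 * pi / lam) * z0) *
    (exp (\<i> * of_real ((2 * pi / lam) / z0 *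
        ((fst (pos j) - fst (a q))\<^sup>2 + (snd (pos j) - snd (a q))\<^sup>2))) / sqrt (real CARD('n)))"
proof -
  define w where "w = 2 * pi / lam"
  have g: "(paraxial_green w z0 (pos j) (a q))\<^sup>2 = cis (2 * w * z0) *
     exp (\<i> * of_real (w / z0 * ((fst (pos j) - fst (a q))\<^sup>2 + (snd (pos j) - snd (a q))\<^sup>2)))
     / of_real ((4 * pi * z0)\<^sup>2)" for q
  proof -
    define u where "u = w * (fst (pos j) - fst (a q))\<^sup>2 / (2 * z0)"
    define v where "v = w * (snd (pos j) - snd (a q))\<^sup>2 / (2 * z0)"
    have e: "w / z0 * ((fst (pos j) - fst (a q))\<^sup>2 + (snd (pos j) - snd (a q))\<^sup>2) = 2 * u + 2 * v"
      using assms by (simp add: u_def v_def field_simps)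
    have "paraxial_green w z0 (pos j) (a q) = cis (w * z0 + u + v) / of_real (4 * pi * z0)"
      unfolding paraxial_green_def exp_i_eq_cis power2_abs u_def[symmetric] v_def[symmetric]
      by (simp add: cis_mult)
    hence "(paraxial_green w z0 (pos j) (a q))\<^sup>2 =
        cis (w * z0 + u + v) ^ 2 / of_real ((4 * pi * z0)\<^sup>2)"
      by (simp add: power_divide)
    also have "cis (w * z0 + u + v) ^ 2 = cis (2 * w * z0) * cis (2 * u + 2 * v)"
      by (simp add: power2_eq_square cis_mult algebra_simps)
    finally show ?thesis by (simp only: e exp_i_eq_cis)
  qed
  have n: "norm ((paraxial_green w z0 (pos j) (a q))\<^sup>2) = 1 / (4 * pi * z0)\<^sup>2" for q
    unfolding g exp_i_eq_cis norm_divide norm_mult norm_cis norm_of_real by simp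
  have c: "norm (column j (\<chi> q j. (paraxial_green w z0 (pos j) (a q))\<^sup>2) :: complex ^ 'n) =
      sqrt (real CARD('n)) / (4 * pi * z0)\<^sup>2"
    by (simp add: norm_vec_def L2_set_def column_def n real_sqrt_mult real_sqrt_divide
        del: norm_power)
  show ?thesis
    unfolding SA_matrix_def normalize_columns_def w_def[symmetric]
    using assms by (simp add: c g del: of_real_power of_real_mult)
qed

end

theory Submission
  imports Defs
begin

text \<open>
  Only the sensors and the phases of the targets need to be random: the argument works for each fixed
  support \<open>S\<close>. Up to unimodular row and column factors the sensing matrix is a Fourier matrix with
  independent random frequencies, and \<open>2 / \<rho> \<in> \<nat>\<close> makes its characters orthogonal. The Gram matrix
  restricted to \<open>S\<close> is thus an average of independent rank one matrices with mean the identity. An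
  exchangeable pair argument bounds the trace moments of its deviation, so the restricted Gram matrix
  is within \<open>1/4\<close> of the identity except with probability \<open>\<delta>/2\<close>. The products of two distinct
  columns are Steinhaus sums, and their moments give the coherence bound
  \<open>8 ln (2m/\<delta>) / n\<close> for the squared inner products. Both bounds hold with probability at least
  \<open>1 - \<delta>\<close>. Given them, each column off \<open>S\<close> has a dual vector of squared norm at most
  \<open>2 / (9 ln (m/\<epsilon>))\<close>, whose correlation with the independent target phases is again a Steinhaus sum
  and is less than \<open>1\<close> for all columns with probability at least \<open>1 - \<epsilon>\<close>.
\<close>

section \<open>A trace inequality for powers of Hermitian matrices\<close>

text \<open>The obstacle is that the admissible sparsity is linear in \<open>n\<close> up to
  logarithms. The entries of the Gram matrix off the diagonal are only bounded by a multiple of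
  \<open>sqrt (\<Lambda> / n)\<close>, with \<open>\<Lambda> = ln (2 * m / delta)\<close>, and a
  worst-case argument from this alone stops at a sparsity of order \<open>sqrt n\<close>. Two
  averages remove the square root: the Gram block on \<open>S\<close> is controlled as one matrix
  instead of entry by entry, and the dual vector is paired with random phases, so that its l2 norm
  counts and not its l1 norm. The law of the support is a finite mixture over \<open>S\<close>, so
  the good sensor event may depend on \<open>S\<close>, and no bound uniform over all supports is
  needed. Matrix concentration is done without eigenvalues: the trace of an even power is the only
  measure of size, and Cauchy-Schwarz for the Frobenius inner product is the only tool. All three
  tails are Markov bounds at a moment of logarithmic order. The order is the wanted exponent rounded
  up, and the thresholds make the base of the resulting power at most 1/3, which is below
  \<open>exp (- 1)\<close>.\<close>

definition hadj :: "complex ^ 'n ^ 'm \<Rightarrow> complex ^ 'm ^ 'n" where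
  "hadj A = (\<chi> i j. cnj (A $ j $ i))"

definition hermitian :: "complex ^ 'm ^ 'm \<Rightarrow> bool" where
  "hermitian A \<longleftrightarrow> hadj A = A"

text \<open>Used mostly as \<open>rtr (hadj A ** B)\<close>, the real part of the Frobenius inner
  product, so that all trace inequalities are inequalities of reals.\<close>

definition rtr :: "complex ^ 'm ^ 'm \<Rightarrow> real" where
  "rtr A = Re (trace A)"

primrec mpow :: "complex ^ 'm ^ 'm \<Rightarrow> nat \<Rightarrow> complex ^ 'm ^ 'm" where
  "mpow A 0 = mat 1"
| "mpow A (Suc k) = A ** mpow A k"

lemma hadj_mult: "hadj (A ** B) = hadj B ** hadj A"
  by (simp add: hadj_def matrix_matrix_mult_def vec_eq_iff mult.commute)

lemma hadj_hadj [simp]: "hadj (hadj A) = A"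
  by (simp add: hadj_def vec_eq_iff)

lemma hadj_diff: "hadj (A - B) = hadj A - hadj B"
  by (simp add: hadj_def vec_eq_iff)

lemma hadj_mat_1 [simp]: "hadj (mat 1) = mat 1"
  by (simp add: hadj_def mat_def vec_eq_iff)

lemma mpow_add: "mpow A (i + j) = mpow A i ** mpow A j"
  by (induction i) (simp_all add: matrix_mul_assoc)

lemma mpow_Suc_right: "mpow A (Suc k) = mpow A k ** A"
  using mpow_add[of A k 1] by simp

lemma hermitian_mpow:
  assumes "hermitian A"
  shows "hermitian (mpow A k)"
proof (induction k)
  case (Suc k)
  then show ?case
    using assms by (metis hadj_mult hermitian_def mpow.simps(2) mpow_Suc_right)
qed (simp add: hermitian_def)

lemma rtr_add: "rtr (A + B) = rtr A + rtr B"
  by (simp add: rtr_def trace_add)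

lemma rtr_diff: "rtr (A - B) = rtr A - rtr B"
  by (simp add: rtr_def trace_sub)

lemma rtr_zero [simp]: "rtr 0 = 0"
  by (simp add: rtr_def trace_def)

lemma rtr_sum: "rtr (sum F I) = (\<Sum>i\<in>I. rtr (F i))"
  by (induction I rule: infinite_finite_induct) (simp_all add: rtr_add)

lemma rtr_scaleR: "rtr (c *\<^sub>R A) = c * rtr A"
  by (simp add: rtr_def trace_def flip: sum_distrib_left)

lemma rtr_mult_commute: "rtr (A ** B) = rtr (B ** A)"
  unfolding rtr_def by (subst trace_mul_sym) (rule refl)

lemma rtr_hadj: "rtr (hadj A) = rtr A"
  by (simp add: rtr_def trace_def hadj_def)

lemma rtr_gram:
  "rtr (hadj A ** A) = (\<Sum>i\<in>UNIV. \<Sum>j\<in>UNIV. (norm (A $ j $ i))\<^sup>2)"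
  by (simp add: rtr_def trace_def hadj_def matrix_matrix_mult_def cmod_power2 flip: power2_eq_square)

lemma rtr_gram_nonneg: "0 \<le> rtr (hadj A ** A)"
  by (simp add: rtr_gram sum_nonneg)

lemma matrix_diff_distrib: "(A :: complex ^ 'm ^ 'n) ** (B - C) = A ** B - A ** C"
  "(B' - C') ** (A' :: complex ^ 'm ^ 'n) = B' ** A' - C' ** A'"
  by (simp_all add: matrix_matrix_mult_def vec_eq_iff sum_subtractf algebra_simps)

lemma matrix_add_distrib: "(A :: complex ^ 'm ^ 'n) ** (B + C) = A ** B + A ** C"
  "(B' + C') ** (A' :: complex ^ 'm ^ 'n) = B' ** A' + C' ** A'"
  by (simp_all add: matrix_matrix_mult_def vec_eq_iff sum.distrib algebra_simps)

lemma matrix_sum_distrib: "(A :: complex ^ 'm ^ 'n) ** (sum F I) = (\<Sum>i\<in>I. A ** F i)"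
  by (induction I rule: infinite_finite_induct) (simp_all add: matrix_add_distrib)

lemma matrix_sum_distrib_right: "(sum F I) ** (A :: complex ^ 'm ^ 'n) = (\<Sum>i\<in>I. F i ** A)"
  by (induction I rule: infinite_finite_induct) (simp_all add: matrix_add_distrib)

lemma matrix_scaleR_mult:
  "(A :: complex ^ 'm ^ 'n) ** (c *\<^sub>R B) = c *\<^sub>R (A ** B)"
  "(c *\<^sub>R A) ** B = c *\<^sub>R (A ** B)"
  by (simp_all add: matrix_matrix_mult_def vec_eq_iff scaleR_sum_right)

text \<open>Expanding the squared Frobenius norm of \<open>A - B\<close> gives Cauchy-Schwarz in
  additive form; rescaling the two factors supplies weights.\<close>

lemma two_rtr_le: "2 * rtr (hadj A ** B) \<le> rtr (hadj A ** A) + rtr (hadj B ** B)"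
proof -
  have "rtr (hadj B ** A) = rtr (hadj A ** B)"
    using rtr_hadj[of "hadj A ** B"] by (simp add: hadj_mult)
  then show ?thesis
    using rtr_gram_nonneg[of "A - B"]
    by (simp add: hadj_diff matrix_diff_distrib rtr_diff)
qed

text \<open>A discrete maximum principle: at an interior maximum both neighbours must attain it too,
  which the leftmost maximiser excludes.\<close>

lemma midpoint_convex_le_ends:
  fixes g :: "nat \<Rightarrow> real"
  assumes conv: "\<And>i. i + 2 \<le> k \<Longrightarrow> 2 * g (i + 1) \<le> g i + g (i + 2)"
    and "g k = g 0" and "i \<le> k"
  shows "g i \<le> g 0"
proof (rule ccontr)
  assume n: "\<not> g i \<le> g 0"
  define M where "M = Max (g ` {..k})"
  define j where "j = (LEAST j. j \<le> k \<and> g j = M)"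
  have "M \<in> g ` {..k}" unfolding M_def by (rule Max_in) auto
  then have ex: "\<exists>j. j \<le> k \<and> g j = M" by auto
  have j: "j \<le> k" "g j = M" using LeastI_ex[OF ex] by (auto simp: j_def)
  have le: "g x \<le> M" if "x \<le> k" for x using that by (auto simp: M_def intro: Max_ge)
  have "M > g 0" using le[OF \<open>i \<le> k\<close>] n by linarith
  then have "j \<noteq> 0" "j \<noteq> k" using j assms(2) by (metis less_irrefl)+
  then obtain j' where j': "j = j' + 1" "j' + 2 \<le> k" using j(1)
    by (cases j) auto
  have "g j' < M" using not_less_Least[of j' "\<lambda>j. j \<le> k \<and> g j = M"] le[of j'] j'
    unfolding j_def[symmetric] by (auto simp: less_le)
  moreover have "2 * M \<le> g j' + g (j' + 2)" using conv[OF j'(2)] j j' by simp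
  ultimately show False using le[OF j'(2)] by simp
qed

text \<open>
  With \<open>t i = rtr (D ** mpow A i ** D ** mpow B (2 * k - i))\<close>, Cauchy-Schwarz for the Frobenius inner
  product makes \<open>t\<close> midpoint convex along even indices and bounds each odd term by the mean of its
  neighbours.
\<close>

lemma sum_rtr_mpow_le:
  assumes A: "hermitian A" and B: "hermitian B" and D: "hermitian D"
  shows "(\<Sum>i\<le>2 * k. rtr (D ** mpow A i ** D ** mpow B (2 * k - i)))
    \<le> (2 * real k + 1) / 2 * (rtr (D ** D ** mpow A (2 * k)) + rtr (D ** D ** mpow B (2 * k)))"
proof -
  define u where "u a b = rtr (D ** mpow A a ** D ** mpow B b)" for a b
  have u_mid: "2 * u (a + a') (b + b') \<le> u (2 * a) (2 * b) + u (2 * a') (2 * b')" for a a' b b'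
  proof -
    let ?X = "\<lambda>a b. mpow A a ** D ** mpow B b"
    have "rtr (hadj (?X a b) ** ?X a' b') = u (a + a') (b' + b)" for a a' b b'
    proof -
      have "hadj (?X a b) = mpow B b ** D ** mpow A a"
        using hermitian_mpow[OF A, of a] hermitian_mpow[OF B, of b] D
        by (simp add: hadj_mult hermitian_def matrix_mul_assoc)
      then have "rtr (hadj (?X a b) ** ?X a' b') =
          rtr (mpow B b ** (D ** mpow A (a + a') ** D ** mpow B b'))"
        by (simp add: mpow_add matrix_mul_assoc)
      also have "\<dots> = u (a + a') (b' + b)"
        by (subst rtr_mult_commute) (simp add: u_def mpow_add matrix_mul_assoc)
      finally show ?thesis .
    qed
    then show ?thesis
      using two_rtr_le[of "?X a b" "?X a' b'"] by (simp only: mult_2 add.commute[of b' b])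
  qed
  define e where "e i = u (2 * i) (2 * (k - i))" for i
  have conv: "2 * e (i + 1) \<le> e i + e (i + 2)" if "i + 2 \<le> k" for i
  proof -
    from that have eq: "i + (i + 2) = 2 * (i + 1)" "(k - i) + (k - (i + 2)) = 2 * (k - (i + 1))"
      by auto
    from u_mid[of i "i + 2" "k - i" "k - (i + 2)"] show ?thesis by (simp only: e_def eq)
  qed
  have odd: "2 * u (2 * i + 1) (2 * k - (2 * i + 1)) \<le> e i + e (i + 1)" if "i < k" for i
  proof -
    from that have eq: "i + (i + 1) = 2 * i + 1" "(k - i) + (k - (i + 1)) = 2 * k - (2 * i + 1)"
      by auto
    from u_mid[of i "i + 1" "k - i" "k - (i + 1)"] show ?thesis by (simp only: e_def eq)
  qed
  \<comment> \<open>Symmetrising under the reflection of \<open>i\<close> makes the two end values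
    equal, as the maximum principle requires.\<close>
  have "e i + e (k - i) \<le> e 0 + e k" if "i \<le> k" for i
  proof -
    have "2 * (e (i + 1) + e (k - (i + 1))) \<le> (e i + e (k - i)) + (e (i + 2) + e (k - (i + 2)))"
      if "i + 2 \<le> k" for i
    proof -
      from that have "(k - (i + 2)) + 1 = k - (i + 1)" "(k - (i + 2)) + 2 = k - i" by auto
      with conv[OF that] conv[of "k - (i + 2)"] that show ?thesis by simp
    qed
    from midpoint_convex_le_ends[of k "\<lambda>i. e i + e (k - i)", OF this _ that] show ?thesis by simp
  qed
  then have "(\<Sum>i\<le>k. e i + e (k - i)) \<le> (\<Sum>i\<le>k. e 0 + e k)" by (intro sum_mono) simp
  moreover have "(\<Sum>i\<le>k. e (k - i)) = (\<Sum>i\<le>k. e i)"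
    by (rule sum.reindex_bij_witness[of _ "\<lambda>i. k - i" "\<lambda>i. k - i"]) auto
  ultimately have ev: "2 * (\<Sum>i\<le>k. e i) \<le> (real k + 1) * (e 0 + e k)"
    by (simp add: sum.distrib add.commute)
  have "(\<Sum>i<k. 2 * u (2 * i + 1) (2 * k - (2 * i + 1))) \<le> (\<Sum>i<k. e i + e (i + 1))"
    by (rule sum_mono) (use odd in auto)
  also have "\<dots> = (\<Sum>i<k. e i) + (\<Sum>i<k. e (Suc i))" by (simp add: sum.distrib)
  also have "\<dots> = 2 * (\<Sum>i\<le>k. e i) - e 0 - e k"
    using sum.lessThan_Suc_shift[of e k] sum.lessThan_Suc[of e k]
    unfolding lessThan_Suc_atMost by linarith
  finally have od: "2 * (\<Sum>i<k. u (2 * i + 1) (2 * k - (2 * i + 1))) \<le> 2 * (\<Sum>i\<le>k. e i) - e 0 - e k"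
    by (simp add: sum_distrib_left)
  have split: "(\<Sum>i\<le>2 * k. F i) = (\<Sum>i\<le>k. F (2 * i)) + (\<Sum>i<k. F (2 * i + 1))"
    for F :: "nat \<Rightarrow> real"
    by (induction k) simp_all
  have "(\<Sum>i\<le>2 * k. u i (2 * k - i)) = (\<Sum>i\<le>k. e i) + (\<Sum>i<k. u (2 * i + 1) (2 * k - (2 * i + 1)))"
    by (simp add: split e_def diff_mult_distrib2)
  \<comment> \<open>With the odd terms replaced by means of neighbours, the even sum occurs twice,
    except that half of each end value is missing; hence the factor
    \<open>k + 1 - 1 / 2\<close>.\<close>
  also have "\<dots> \<le> (2 * real k + 1) / 2 * (e 0 + e k)"
    using ev od by (simp add: field_simps)
  also have "e 0 = rtr (D ** D ** mpow B (2 * k))" by (simp add: e_def u_def)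
  also have "e k = rtr (D ** D ** mpow A (2 * k))"
    unfolding e_def u_def by (simp, subst (2) rtr_mult_commute[symmetric])
      (metis matrix_mul_assoc rtr_mult_commute)
  finally show ?thesis by (simp add: u_def add.commute)
qed

text \<open>Noncommutative telescoping: the factors \<open>A\<close> turn into \<open>B\<close> one
  at a time, and each exchange leaves one factor \<open>A - B\<close>.\<close>

lemma mpow_diff:
  "mpow A (Suc p) - mpow B (Suc p) = (\<Sum>i\<le>p. mpow A i ** (A - B) ** mpow B (p - i))"
proof (induction p)
  case (Suc p)
  have "mpow A (Suc (Suc p)) - mpow B (Suc (Suc p)) =
      A ** (mpow A (Suc p) - mpow B (Suc p)) + (A - B) ** mpow B (Suc p)"
    by (simp add: matrix_diff_distrib)
  also have "\<dots> = (\<Sum>i\<le>p. mpow A (Suc i) ** (A - B) ** mpow B (p - i)) + (A - B) ** mpow B (Suc p)"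
    unfolding Suc matrix_sum_distrib by (simp add: matrix_mul_assoc)
  also have "\<dots> = (\<Sum>i\<le>Suc p. mpow A i ** (A - B) ** mpow B (Suc p - i))"
    by (simp add: sum.atMost_Suc_shift del: sum.atMost_Suc)
  finally show ?case .
qed simp

text \<open>The trace form of the scalar estimate of \<open>(a - b) * (a ^ p - b ^ p)\<close> by
  \<open>p / 2 * (a - b)^2 * (a ^ (p - 1) + b ^ (p - 1))\<close>. The exponent
  \<open>p = 2 * k + 1\<close> is odd, so the powers on the right are even and positive
  semidefinite.\<close>

lemma rtr_diff_mpow_le:
  assumes A: "hermitian A" and B: "hermitian B"
  shows "rtr ((A - B) ** (mpow A (2 * k + 1) - mpow B (2 * k + 1)))
    \<le> (2 * real k + 1) / 2 *
       (rtr ((A - B) ** (A - B) ** mpow A (2 * k)) + rtr ((A - B) ** (A - B) ** mpow B (2 * k)))"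
proof -
  have "hermitian (A - B)" using A B by (simp add: hermitian_def hadj_diff)
  from sum_rtr_mpow_le[OF A B this, of k] show ?thesis
    by (simp add: mpow_diff matrix_sum_distrib rtr_sum matrix_mul_assoc del: mpow.simps)
qed

lemma rtr_mpow_even: "hermitian A \<Longrightarrow> rtr (mpow A (2 * k)) = rtr (hadj (mpow A k) ** mpow A k)"
  using hermitian_mpow[of A k] by (simp add: mult_2 mpow_add hermitian_def)

lemma rtr_mpow_even_nonneg: "hermitian A \<Longrightarrow> 0 \<le> rtr (mpow A (2 * k))"
  by (simp add: rtr_mpow_even rtr_gram_nonneg)

text \<open>Interpolates an odd trace, whose sign is unknown, between its two even neighbours. The
  weight \<open>c\<close> stays free so that the higher moment can later be absorbed.\<close>

lemma rtr_mpow_odd_le: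
  assumes A: "hermitian A" and "c > 0"
  shows "2 * \<bar>rtr (mpow A (2 * k + 1))\<bar> \<le> c * rtr (mpow A (2 * k + 2)) + rtr (mpow A (2 * k)) / c"
proof -
  define x where "x = sqrt c"
  have x: "x > 0" "x * x = c" "inverse x * inverse x = 1 / c"
    using \<open>c > 0\<close> by (simp_all add: x_def real_inv_sqrt_pow2[unfolded power2_eq_square] inverse_eq_divide)
  have "hadj (mpow A i) = mpow A i" for i
    using hermitian_mpow[OF A, of i] by (simp add: hermitian_def)
  then have sc: "hadj (r *\<^sub>R mpow A i) = r *\<^sub>R mpow A i" for r i
    by (simp add: hadj_def vec_eq_iff)
  have p: "mpow A (k + 1) ** mpow A k = mpow A (2 * k + 1)"
    "mpow A k ** mpow A k = mpow A (2 * k)" "mpow A (k + 1) ** mpow A (k + 1) = mpow A (2 * k + 2)"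
    by (simp_all add: mpow_add[symmetric] mult_2 del: mpow.simps)
  \<comment> \<open>The sign \<open>r\<close> goes into one of the two factors of Cauchy-Schwarz, so
    the cases 1 and -1 together give the absolute value.\<close>
  have "2 * (r * rtr (mpow A (2 * k + 1))) \<le> c * rtr (mpow A (2 * k + 2)) + rtr (mpow A (2 * k)) / c"
    if "r = 1 \<or> r = -1" for r
  proof -
    from that have r: "r * r = 1" by auto
    have "(r * inverse x) * (x * t) = r * t" "x * (x * t) = c * t"
      "(r * inverse x) * ((r * inverse x) * t) = t / c" for t
    proof -
      have "(r * inverse x) * ((r * inverse x) * t) = (r * r) * (inverse x * inverse x) * t"
        by (simp only: ac_simps)
      then show "(r * inverse x) * ((r * inverse x) * t) = t / c" using r x by simp
    qed (use x in \<open>simp_all add: mult.assoc[symmetric]\<close>)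
    with two_rtr_le[of "x *\<^sub>R mpow A (k + 1)" "(r * inverse x) *\<^sub>R mpow A k"]
    show ?thesis
      by (simp only: sc matrix_scaleR_mult rtr_scaleR p)
  qed
  from this[of 1] this[of "-1"] show ?thesis by (simp add: abs_if)
qed

section \<open>Operator norm bounds from the trace of one even power\<close>

lemma inner_hermitian:
  fixes A :: "complex ^ 'a ^ 'a"
  assumes "hermitian A"
  shows "(A *v x) \<bullet> y = x \<bullet> (A *v y)"
proof -
  have A: "A $ i $ j = cnj (A $ j $ i)" for i j
    using arg_cong[OF assms[unfolded hermitian_def], of "\<lambda>B. B $ i $ j"] by (simp add: hadj_def)
  have inner: "u \<bullet> v = Re (\<Sum>i\<in>UNIV. u $ i * cnj (v $ i))" for u v :: "complex ^ 'a"
    by (simp add: inner_vec_def inner_complex_def)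
  have "(A *v x) \<bullet> y = Re (\<Sum>i\<in>UNIV. \<Sum>j\<in>UNIV. A $ i $ j * x $ j * cnj (y $ i))"
    unfolding inner matrix_vector_mult_def by (simp only: vec_lambda_beta sum_distrib_right)
  also have "\<dots> = Re (\<Sum>j\<in>UNIV. \<Sum>i\<in>UNIV. A $ i $ j * x $ j * cnj (y $ i))"
    by (subst sum.swap) (rule refl)
  also have "\<dots> = Re (\<Sum>j\<in>UNIV. \<Sum>i\<in>UNIV. x $ j * cnj (A $ j $ i * y $ i))"
    by (intro arg_cong[of _ _ Re] sum.cong refl) (subst A, simp only: complex_cnj_mult mult_ac)
  also have "\<dots> = x \<bullet> (A *v y)"
    unfolding inner matrix_vector_mult_def by (simp only: vec_lambda_beta sum_distrib_left cnj_sum)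
  finally show ?thesis .
qed

lemma norm_matrix_vector_le_frobenius:
  fixes A :: "complex ^ 'm ^ 'm"
  shows "(norm (A *v x))\<^sup>2 \<le> rtr (hadj A ** A) * (norm x)\<^sup>2"
proof -
  have "(norm ((A *v x) $ i))\<^sup>2 \<le> (\<Sum>j\<in>UNIV. (norm (A $ i $ j))\<^sup>2) * (norm x)\<^sup>2" for i
  proof -
    have "norm ((A *v x) $ i) \<le> (\<Sum>j\<in>UNIV. \<bar>norm (A $ i $ j)\<bar> * \<bar>norm (x $ j)\<bar>)"
      by (simp add: matrix_vector_mult_def norm_mult[symmetric] norm_sum)
    also have "\<dots> \<le> L2_set (\<lambda>j. norm (A $ i $ j)) UNIV * norm x"
      unfolding norm_vec_def by (rule L2_set_mult_ineq)
    finally have "(norm ((A *v x) $ i))\<^sup>2 \<le> (L2_set (\<lambda>j. norm (A $ i $ j)) UNIV * norm x)\<^sup>2"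
      by (rule power_mono) simp
    then show ?thesis
      by (simp add: power_mult_distrib L2_set_def sum_nonneg)
  qed
  then have "(\<Sum>i\<in>UNIV. (norm ((A *v x) $ i))\<^sup>2)
      \<le> (\<Sum>i\<in>UNIV. (\<Sum>j\<in>UNIV. (norm (A $ i $ j))\<^sup>2) * (norm x)\<^sup>2)"
    by (rule sum_mono)
  also have "\<dots> = rtr (hadj A ** A) * (norm x)\<^sup>2"
    unfolding rtr_gram by (subst sum.swap) (simp add: sum_distrib_right)
  finally show ?thesis
    by (simp add: norm_vec_def L2_set_def sum_nonneg)
qed

text \<open>Replaces the spectral theorem. The norms of the iterates of \<open>A\<close> on
  \<open>x\<close> are log-convex, so the \<open>k\<close>-th power of the first growth ratio is at
  most the growth over \<open>k\<close> steps, and the Frobenius norm of \<open>mpow A k\<close>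
  bounds the latter.\<close>

lemma norm_hermitian_le:
  assumes A: "hermitian A" and k: "k \<ge> 1" and t: "t \<ge> 0"
    and tr: "rtr (mpow A (2 * k)) \<le> t ^ (2 * k)"
  shows "norm (A *v x) \<le> t * norm x"
proof (cases "x = 0")
  case False
  define v where "v i = mpow A i *v x" for i
  have v: "v 0 = x" "v 1 = A *v x" "A *v v i = v (Suc i)" for i
    by (simp_all add: v_def matrix_vector_mul_assoc)
  have cs: "norm (v (Suc i)) * norm (v (Suc i)) \<le> norm (v i) * norm (v (Suc (Suc i)))" for i
  proof -
    have "v (Suc i) \<bullet> v (Suc i) = v i \<bullet> v (Suc (Suc i))"
      using inner_hermitian[OF A, of "v i" "v (Suc i)"] by (simp add: v)
    then show ?thesis
      using norm_cauchy_schwarz[of "v i" "v (Suc (Suc i))"]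
      by (simp add: power2_norm_eq_inner[symmetric] power2_eq_square)
  qed
  \<comment> \<open>Log-convexity makes successive ratios nondecreasing. The product form avoids
    dividing by iterates that may vanish.\<close>
  have ratio: "norm (v 1) * norm (v i) \<le> norm x * norm (v (Suc i))" for i
  proof (induction i)
    case (Suc i)
    show ?case
    proof (cases "v (Suc i) = 0")
      case False
      have "norm (v 1) * (norm (v (Suc i)) * norm (v (Suc i)))
          \<le> (norm (v 1) * norm (v i)) * norm (v (Suc (Suc i)))"
        using mult_left_mono[OF cs[of i], of "norm (v 1)"] by (simp add: mult.assoc)
      also have "\<dots> \<le> (norm x * norm (v (Suc i))) * norm (v (Suc (Suc i)))"
        by (rule mult_right_mono[OF Suc]) simp
      finally have "norm (v (Suc i)) * (norm (v 1) * norm (v (Suc i)))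
          \<le> norm (v (Suc i)) * (norm x * norm (v (Suc (Suc i))))"
        by (simp add: mult_ac)
      then show ?thesis using False by simp
    qed simp
  qed (simp add: v)
  have pw: "norm (v 1) ^ i * norm x \<le> norm x ^ i * norm (v i)" for i
  proof (induction i)
    case (Suc i)
    have "norm (v 1) ^ Suc i * norm x \<le> norm (v 1) * (norm x ^ i * norm (v i))"
      using mult_left_mono[OF Suc, of "norm (v 1)"] by (simp add: mult.assoc)
    also have "\<dots> \<le> norm x ^ i * (norm x * norm (v (Suc i)))"
      using mult_left_mono[OF ratio[of i], of "norm x ^ i"] by (simp add: mult_ac)
    finally show ?case by (simp add: mult_ac)
  qed (simp add: v)
  have "(norm (v k))\<^sup>2 \<le> rtr (mpow A (2 * k)) * (norm x)\<^sup>2"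
    using norm_matrix_vector_le_frobenius[of "mpow A k" x]
    by (simp add: v_def rtr_mpow_even[OF A])
  also have "\<dots> \<le> t ^ (2 * k) * (norm x)\<^sup>2" by (rule mult_right_mono[OF tr]) simp
  also have "\<dots> = (t ^ k * norm x)\<^sup>2" by (simp add: power_mult_distrib power_mult[symmetric] mult.commute)
  finally have "norm (v k) \<le> t ^ k * norm x" by (rule power2_le_imp_le) (use t in simp)
  then have "norm (v 1) ^ k * norm x \<le> norm x ^ k * (t ^ k * norm x)"
    using pw[of k] by (meson mult_left_mono norm_ge_zero order_trans zero_le_power)
  then have "norm (v 1) ^ k * norm x \<le> (t * norm x) ^ k * norm x"
    by (simp add: power_mult_distrib mult_ac)
  then have "norm (v 1) ^ k \<le> (t * norm x) ^ k" using False by simp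
  then show ?thesis
    using power_mono_iff[of "norm (v 1)" "t * norm x" k] k t unfolding v by simp
qed simp

section \<open>Moments of sums of independent rank one matrices\<close>

definition outer :: "complex ^ 'm \<Rightarrow> complex ^ 'm ^ 'm" where
  "outer x = (\<chi> i j. x $ i * cnj (x $ j))"

definition coord_proj :: "'m set \<Rightarrow> complex ^ 'm ^ 'm" where
  "coord_proj S = (\<chi> i j. if i = j \<and> i \<in> S then 1 else 0)"

lemma hermitian_outer: "hermitian (outer x)"
  by (simp add: hermitian_def hadj_def outer_def vec_eq_iff mult.commute)

lemma hermitian_coord_proj: "hermitian (coord_proj S)"
  by (auto simp: hermitian_def hadj_def coord_proj_def vec_eq_iff)

lemma hermitian_diff: "hermitian A \<Longrightarrow> hermitian B \<Longrightarrow> hermitian (A - B)"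
  by (simp add: hermitian_def hadj_diff)

lemma hermitian_sum: "(\<And>i. i \<in> I \<Longrightarrow> hermitian (F i)) \<Longrightarrow> hermitian (sum F I)"
  by (simp add: hermitian_def hadj_def vec_eq_iff)

lemma coord_proj_mult: "(coord_proj S ** A) $ i $ j = (if i \<in> S then A $ i $ j else 0)"
  by (simp add: coord_proj_def matrix_matrix_mult_def if_distrib[of "\<lambda>x. x * _"] sum.delta cong: if_cong)

lemma mult_coord_proj: "(A ** coord_proj S) $ i $ j = (if j \<in> S then A $ i $ j else 0)"
proof -
  have "(A ** coord_proj S) $ i $ j = (\<Sum>k\<in>UNIV. if k = j then (if j \<in> S then A $ i $ j else 0) else 0)"
    unfolding matrix_matrix_mult_def coord_proj_def vec_lambda_beta by (rule sum.cong) auto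
  then show ?thesis by simp
qed

section \<open>Bounded measurable matrix functions\<close>

definition bounded_measurable :: "'a measure \<Rightarrow> ('a \<Rightarrow> complex) \<Rightarrow> bool" where
  "bounded_measurable N g \<longleftrightarrow> g \<in> borel_measurable N \<and> (\<exists>B. \<forall>x. norm (g x) \<le> B)"

definition mat_bm :: "'a measure \<Rightarrow> ('a \<Rightarrow> complex ^ 'm ^ 'm) \<Rightarrow> bool" where
  "mat_bm N F \<longleftrightarrow> (\<forall>i j. bounded_measurable N (\<lambda>x. F x $ i $ j))"

lemma bm_const: "bounded_measurable N (\<lambda>_. c)"
  by (auto simp: bounded_measurable_def)

lemma bm_add:
  assumes "bounded_measurable N g" "bounded_measurable N h"
  shows "bounded_measurable N (\<lambda>x. g x + h x)"
proof -
  obtain B C where "\<And>x. norm (g x) \<le> B" "\<And>x. norm (h x) \<le> C"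
    using assms by (auto simp: bounded_measurable_def)
  then have "norm (g x + h x) \<le> B + C" for x by (rule norm_triangle_mono)
  then show ?thesis using assms by (auto simp: bounded_measurable_def)
qed

text \<open>Closure under products is the reason for working with bounded rather than integrable
  functions: it makes every matrix polynomial below integrable at once.\<close>

lemma bm_mult:
  assumes "bounded_measurable N g" "bounded_measurable N h"
  shows "bounded_measurable N (\<lambda>x. g x * h x)"
proof -
  obtain B C where BC: "\<And>x. norm (g x) \<le> B" "\<And>x. norm (h x) \<le> C"
    using assms by (auto simp: bounded_measurable_def)
  have "norm (g x * h x) \<le> B * C" for x
    unfolding norm_mult using BC[of x] by (intro mult_mono) (auto intro: order_trans[OF norm_ge_zero])
  then show ?thesis using assms by (auto simp: bounded_measurable_def)
qed

lemma bm_sum: "(\<And>i. i \<in> I \<Longrightarrow> bounded_measurable N (g i)) \<Longrightarrow> bounded_measurable N (\<lambda>x. \<Sum>i\<in>I. g i x)"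
  by (induction I rule: infinite_finite_induct) (auto simp: bm_const intro: bm_add)

lemma bm_cnj: "bounded_measurable N g \<Longrightarrow> bounded_measurable N (\<lambda>x. cnj (g x))"
  by (auto simp: bounded_measurable_def intro: borel_measurable_continuous_on[OF continuous_on_cnj[OF continuous_on_id]])

lemma bm_compose:
  "bounded_measurable N g \<Longrightarrow> h \<in> measurable N' N \<Longrightarrow> bounded_measurable N' (\<lambda>x. g (h x))"
  by (auto simp: bounded_measurable_def intro: measurable_compose)

lemma (in prob_space) bm_integrable: "bounded_measurable M g \<Longrightarrow> integrable M g"
  unfolding bounded_measurable_def by (auto intro!: integrable_const_bound)

lemma mat_bm_const: "mat_bm N (\<lambda>_. A)"
  by (simp add: mat_bm_def bm_const)

lemma mat_bm_diff: "mat_bm N F \<Longrightarrow> mat_bm N G \<Longrightarrow> mat_bm N (\<lambda>x. F x - G x)"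
  using bm_add[OF _ bm_mult[OF bm_const[of N "-1"]]] by (fastforce simp: mat_bm_def)

lemma mat_bm_sum: "(\<And>i. i \<in> I \<Longrightarrow> mat_bm N (F i)) \<Longrightarrow> mat_bm N (\<lambda>x. \<Sum>i\<in>I. F i x)"
  by (simp add: mat_bm_def bm_sum)

lemma mat_bm_mult: "mat_bm N F \<Longrightarrow> mat_bm N G \<Longrightarrow> mat_bm N (\<lambda>x. F x ** G x)"
  by (simp add: mat_bm_def matrix_matrix_mult_def bm_sum bm_mult)

lemma mat_bm_mpow: "mat_bm N F \<Longrightarrow> mat_bm N (\<lambda>x. mpow (F x) k)"
  by (induction k) (simp_all add: mat_bm_const mat_bm_mult)

lemma mat_bm_compose: "mat_bm N F \<Longrightarrow> h \<in> measurable N' N \<Longrightarrow> mat_bm N' (\<lambda>x. F (h x))"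
  unfolding mat_bm_def using bm_compose by blast

lemma bm_trace: "mat_bm N F \<Longrightarrow> bounded_measurable N (\<lambda>x. trace (F x))"
  by (simp add: mat_bm_def trace_def bm_sum)

lemma mat_bm_rtr_measurable: "mat_bm N F \<Longrightarrow> (\<lambda>x. rtr (F x)) \<in> borel_measurable N"
  using bm_trace[of N F] unfolding rtr_def bounded_measurable_def by (auto intro: borel_measurable_Re)

lemma (in prob_space) mat_bm_integrable: "mat_bm M F \<Longrightarrow> integrable M (\<lambda>x. rtr (F x))"
  unfolding rtr_def by (intro integrable_Re bm_integrable bm_trace)

text \<open>The exchangeability behind the moment recursion: trading the \<open>q\<close>-th sample
  for an independent copy preserves the joint law. It suffices to compare rectangles.\<close>

lemma (in prob_space) swap_coordinate_distr:
  fixes q :: "'n::finite"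
  defines "P \<equiv> Pi\<^sub>M UNIV (\<lambda>_::'n. M)"
  shows "(\<lambda>z. ((fst z)(q := snd z), fst z q)) \<in> measurable (P \<Otimes>\<^sub>M M) (P \<Otimes>\<^sub>M M)"
    and "distr (P \<Otimes>\<^sub>M M) (P \<Otimes>\<^sub>M M) (\<lambda>z. ((fst z)(q := snd z), fst z q)) = P \<Otimes>\<^sub>M M"
proof -
  interpret pr: product_prob_space "\<lambda>_::'n. M" UNIV by unfold_locales
  interpret P: prob_space P unfolding P_def by unfold_locales
  let ?g = "\<lambda>z. ((fst z)(q := snd z), fst z q)"
  have "(\<lambda>z. (fst z)(q := snd z)) \<in> measurable (P \<Otimes>\<^sub>M M) P"
    unfolding P_def by (rule measurable_fun_upd[where J = UNIV]) auto
  moreover have "(\<lambda>z. fst z q) \<in> measurable (P \<Otimes>\<^sub>M M) M"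
    unfolding P_def by measurable
  ultimately show g: "?g \<in> measurable (P \<Otimes>\<^sub>M M) (P \<Otimes>\<^sub>M M)"
    by (rule measurable_Pair)
  let ?Q = "Pi\<^sub>M (UNIV - {q}) (\<lambda>_. M)"
  \<comment> \<open>Splitting off coordinate \<open>q\<close> turns the old value \<open>y\<close>
    and the new value \<open>u\<close> into two integration variables with the same law, whose roles
    the swap exchanges.\<close>
  have ins: "(\<integral>\<^sup>+a. h a \<partial>P) = (\<integral>\<^sup>+x. \<integral>\<^sup>+y. h (x(q := y)) \<partial>M \<partial>?Q)" if "h \<in> borel_measurable P" for h
    using pr.product_nn_integral_insert[of "UNIV - {q}" q h] that by (simp add: P_def insert_UNIV)
  show "distr (P \<Otimes>\<^sub>M M) (P \<Otimes>\<^sub>M M) ?g = P \<Otimes>\<^sub>M M"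
  proof (rule pair_measure_eqI[symmetric])
    fix A B assume A[measurable]: "A \<in> sets P" and B[measurable]: "B \<in> sets M"
    have [measurable]: "(\<lambda>x. x(q := u)) \<in> measurable ?Q P" if "u \<in> space M" for u
      unfolding P_def using that by (intro measurable_fun_upd[where J = "UNIV - {q}"]) auto
    have "emeasure (distr (P \<Otimes>\<^sub>M M) (P \<Otimes>\<^sub>M M) ?g) (A \<times> B)
        = (\<integral>\<^sup>+z. indicator (A \<times> B) z \<partial>distr (P \<Otimes>\<^sub>M M) (P \<Otimes>\<^sub>M M) ?g)"
      by (subst nn_integral_indicator) auto
    also have "\<dots> = (\<integral>\<^sup>+z. indicator (A \<times> B) (?g z) \<partial>(P \<Otimes>\<^sub>M M))"
      by (rule nn_integral_distr[OF g]) auto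
    also have "\<dots> = (\<integral>\<^sup>+a. \<integral>\<^sup>+u. indicator (A \<times> B) (?g (a, u)) \<partial>M \<partial>P)"
      by (rule nn_integral_fst[symmetric]) (rule measurable_compose[OF g], auto)
    also have "\<dots> = (\<integral>\<^sup>+x. \<integral>\<^sup>+y. \<integral>\<^sup>+u. indicator (A \<times> B) (?g (x(q := y), u)) \<partial>M \<partial>M \<partial>?Q)"
      by (rule ins) (rule borel_measurable_nn_integral_fst, rule measurable_compose[OF g], auto)
    also have "\<dots> = (\<integral>\<^sup>+x. \<integral>\<^sup>+y. \<integral>\<^sup>+u. indicator A (x(q := u)) * indicator B y \<partial>M \<partial>M \<partial>?Q)"
      by (intro nn_integral_cong) (auto simp: indicator_def)
    also have "\<dots> = (\<integral>\<^sup>+x. \<integral>\<^sup>+u. indicator A (x(q := u)) * emeasure M B \<partial>M \<partial>?Q)"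
    proof (rule nn_integral_cong)
      fix x assume x: "x \<in> space ?Q"
      have "(\<lambda>u. x(q := u)) \<in> measurable M P"
        unfolding P_def using x by (intro measurable_fun_upd[where J = "UNIV - {q}"]) auto
      then have m: "(\<lambda>u. indicator A (x(q := u)) :: ennreal) \<in> borel_measurable M"
        by (rule measurable_compose) auto
      show "(\<integral>\<^sup>+y. \<integral>\<^sup>+u. indicator A (x(q := u)) * indicator B y \<partial>M \<partial>M)
          = (\<integral>\<^sup>+u. indicator A (x(q := u)) * emeasure M B \<partial>M)"
        using m by (simp add: nn_integral_multc nn_integral_cmult)
    qed
    also have "\<dots> = (\<integral>\<^sup>+a. indicator A a * emeasure M B \<partial>P)"
      by (rule ins[symmetric]) measurable
    also have "\<dots> = emeasure P A * emeasure M B"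
      by (subst nn_integral_multc) auto
    finally show "emeasure P A * emeasure M B = emeasure (distr (P \<Otimes>\<^sub>M M) (P \<Otimes>\<^sub>M M) ?g) (A \<times> B)" ..
  qed (auto intro: P.sigma_finite_measure sigma_finite_measure)
qed

lemma outer_mult: "outer x ** outer x = (norm x)\<^sup>2 *\<^sub>R outer x"
proof -
  have "(outer x ** outer x) $ i $ j = ((norm x)\<^sup>2 *\<^sub>R outer x) $ i $ j" for i j
  proof -
    have "(outer x ** outer x) $ i $ j = (\<Sum>k\<in>UNIV. (x $ k * cnj (x $ k)) * (x $ i * cnj (x $ j)))"
      by (simp add: outer_def matrix_matrix_mult_def mult_ac)
    also have "\<dots> = (\<Sum>k\<in>UNIV. of_real ((norm (x $ k))\<^sup>2)) * (x $ i * cnj (x $ j))"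
      by (simp only: sum_distrib_right complex_norm_square)
    also have "(\<Sum>k\<in>UNIV. of_real ((norm (x $ k))\<^sup>2)) = complex_of_real ((norm x)\<^sup>2)"
      by (simp add: norm_vec_def L2_set_def sum_nonneg)
    finally show ?thesis
      by (simp only: vector_scaleR_component) (simp add: outer_def scaleR_conv_of_real)
  qed
  then show ?thesis by (simp add: vec_eq_iff)
qed

text \<open>The product is the double factorial that arises from iterating the moment recursion. The
  induction step needs \<open>(1 + 1 / R) ^ R\<close> to be at least 2, which is Bernoulli.\<close>

lemma prod_odd_le: "(\<Prod>i<R. 2 * real i + 1) \<le> real R ^ R"
proof (induction R)
  case (Suc R)
  have "(2 * real R + 1) * real R ^ R \<le> real (Suc R) ^ Suc R"
  proof (cases "R = 0")
    case False
    have "1 + real R * (1 / real R) \<le> (1 + 1 / real R) ^ R"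
      by (rule Bernoulli_inequality, rule order_trans[of _ 0]) simp_all
    then have "2 * real R ^ R \<le> (1 + 1 / real R) ^ R * real R ^ R"
      using False by (intro mult_right_mono) auto
    also have "\<dots> = real (Suc R) ^ R"
      using False by (simp add: power_mult_distrib[symmetric] distrib_right add.commute)
    finally have "2 * real R ^ R * real (Suc R) \<le> real (Suc R) ^ R * real (Suc R)"
      by (rule mult_right_mono) simp
    moreover have "(2 * real R + 1) * real R ^ R \<le> 2 * real R ^ R * real (Suc R)"
      by (simp add: algebra_simps)
    ultimately show ?thesis unfolding power_Suc2 by (rule order_trans[rotated])
  qed simp
  moreover have "(2 * real R + 1) * (\<Prod>i<R. 2 * real i + 1) \<le> (2 * real R + 1) * real R ^ R"
    by (rule mult_left_mono[OF Suc]) simp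
  ultimately have "(2 * real R + 1) * (\<Prod>i<R. 2 * real i + 1) \<le> real (Suc R) ^ Suc R"
    by (rule order_trans[rotated])
  then show ?case by (simp only: prod.lessThan_Suc mult.commute)
qed simp

text \<open>One random row of the sensing matrix, set to zero off \<open>S\<close>. Keeping the full
  index type spares a type for each support; \<open>coord_proj S\<close> then plays the part of the
  identity matrix.\<close>

locale isotropic = prob_space +
  fixes f :: "'a \<Rightarrow> complex ^ 'm" and S :: "'m set"
  assumes f_measurable: "\<And>j. (\<lambda>w. f w $ j) \<in> borel_measurable M"
    and f_norm: "\<And>w j. norm (f w $ j) = (if j \<in> S then 1 else 0)"
    and f_iso: "\<And>i j. expectation (\<lambda>w. f w $ i * cnj (f w $ j)) = (if i = j \<and> i \<in> S then 1 else 0)"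
begin

definition dev :: "'a \<Rightarrow> complex ^ 'm ^ 'm" where
  "dev w = outer (f w) - coord_proj S"

definition dev_sum :: "('n::finite \<Rightarrow> 'a) \<Rightarrow> complex ^ 'm ^ 'm" where
  "dev_sum a = (\<Sum>q\<in>UNIV. dev (a q))"

definition trace_moment :: "'n::finite itself \<Rightarrow> nat \<Rightarrow> real" where
  "trace_moment n k = (\<integral>a. rtr (mpow (dev_sum a) (2 * k)) \<partial>Pi\<^sub>M UNIV (\<lambda>_::'n. M))"

lemma hermitian_dev: "hermitian (dev w)"
  by (simp add: dev_def hermitian_diff hermitian_outer hermitian_coord_proj)

lemma hermitian_dev_sum: "hermitian (dev_sum a)"
  by (simp add: dev_sum_def hermitian_sum hermitian_dev)

lemma norm_f: "(norm (f w))\<^sup>2 = card S"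
proof -
  have "(norm (f w))\<^sup>2 = (\<Sum>j\<in>UNIV. (norm (f w $ j))\<^sup>2)"
    by (simp add: norm_vec_def L2_set_def sum_nonneg)
  also have "\<dots> = (\<Sum>j\<in>UNIV. if j \<in> S then 1 else 0)"
    by (intro sum.cong refl) (simp add: f_norm)
  finally show ?thesis by (simp add: sum.If_cases)
qed

lemma f_outside: "j \<notin> S \<Longrightarrow> f w $ j = 0"
  using f_norm[of w j] by simp

lemma outer_proj: "coord_proj S ** outer (f w) = outer (f w)" "outer (f w) ** coord_proj S = outer (f w)"
  by (simp_all add: vec_eq_iff coord_proj_mult mult_coord_proj outer_def f_outside)

lemma mat_bm_outer: "mat_bm M (\<lambda>w. outer (f w))"
proof -
  have "bounded_measurable M (\<lambda>w. f w $ j)" for j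
    unfolding bounded_measurable_def using f_measurable f_norm by (metis order_refl zero_le_one)
  then show ?thesis by (simp add: mat_bm_def outer_def bm_mult bm_cnj)
qed

lemma mat_bm_dev: "mat_bm M dev"
  unfolding dev_def by (intro mat_bm_diff mat_bm_outer mat_bm_const)

lemma mat_bm_dev_sum: "mat_bm (Pi\<^sub>M UNIV (\<lambda>_::'n::finite. M)) dev_sum"
  unfolding dev_sum_def by (intro mat_bm_sum mat_bm_compose[OF mat_bm_dev]) measurable

lemma integral_outer: "expectation (\<lambda>w. rtr (outer (f w) ** W)) = rtr (coord_proj S ** W)"
proof -
  have int: "integrable M (\<lambda>w. f w $ i * cnj (f w $ j))" for i j
    using mat_bm_outer by (auto simp: mat_bm_def outer_def intro: bm_integrable)
  have eq: "trace (X ** W) = (\<Sum>i\<in>UNIV. \<Sum>j\<in>UNIV. X $ i $ j * W $ j $ i)" for X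
    by (simp add: trace_def matrix_matrix_mult_def)
  have "expectation (\<lambda>w. rtr (outer (f w) ** W)) = Re (expectation (\<lambda>w. trace (outer (f w) ** W)))"
    unfolding rtr_def by (intro integral_Re bm_integrable bm_trace mat_bm_mult mat_bm_outer mat_bm_const)
  also have "expectation (\<lambda>w. trace (outer (f w) ** W)) =
      (\<Sum>i\<in>UNIV. \<Sum>j\<in>UNIV. expectation (\<lambda>w. f w $ i * cnj (f w $ j)) * W $ j $ i)"
    unfolding eq by (simp add: outer_def int)
  also have "\<dots> = trace (coord_proj S ** W)"
    unfolding f_iso eq by (simp add: coord_proj_def)
  finally show ?thesis by (simp add: rtr_def)
qed

lemma integral_dev: "expectation (\<lambda>w. rtr (dev w ** W)) = 0"
  using integral_outer[of W]
  by (simp add: dev_def matrix_diff_distrib rtr_diff mat_bm_integrable mat_bm_mult mat_bm_outer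
      mat_bm_const prob_space)

text \<open>With \<open>d = card S\<close>, \<open>G = outer (f v)\<close> and
  \<open>F = outer (f w)\<close>, rank one gives \<open>G ** G = d *\<^sub>R G\<close>, so the
  square is \<open>d G - F G - G F + d F\<close>. Averaging \<open>F\<close> to the projection
  \<open>P\<close> leaves \<open>(d - 2) G + d P\<close>, and \<open>G = dev v + P\<close>.\<close>

lemma integral_dev_diff_square:
  "expectation (\<lambda>w. rtr ((dev v - dev w) ** (dev v - dev w) ** W))
    = (real (card S) - 2) * rtr (dev v ** W) + 2 * (real (card S) - 1) * rtr (coord_proj S ** W)"
proof -
  let ?P = "coord_proj S" and ?d = "real (card S)"
  let ?G = "outer (f v)"
  have sq: "(dev v - dev w) ** (dev v - dev w) =
      ?d *\<^sub>R ?G - outer (f w) ** ?G - ?G ** outer (f w) + ?d *\<^sub>R outer (f w)" for w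
    by (simp add: dev_def matrix_diff_distrib outer_mult norm_f)
  have i: "integrable M (\<lambda>w. rtr (outer (f w) ** W))" for W
    by (intro mat_bm_integrable mat_bm_mult mat_bm_outer mat_bm_const)
  have "rtr ((dev v - dev w) ** (dev v - dev w) ** W) =
      ?d * rtr (?G ** W) - rtr (outer (f w) ** (?G ** W)) - rtr (outer (f w) ** (W ** ?G))
       + ?d * rtr (outer (f w) ** W)" for w
  proof -
    have "rtr (?G ** outer (f w) ** W) = rtr (outer (f w) ** (W ** ?G))"
      by (metis matrix_mul_assoc rtr_mult_commute)
    then show ?thesis
      unfolding sq by (simp add: matrix_diff_distrib matrix_add_distrib rtr_diff rtr_add
          matrix_scaleR_mult rtr_scaleR matrix_mul_assoc)
  qed
  then have "expectation (\<lambda>w. rtr ((dev v - dev w) ** (dev v - dev w) ** W)) =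
      ?d * rtr (?G ** W) - rtr (?P ** (?G ** W)) - rtr (?P ** (W ** ?G)) + ?d * rtr (?P ** W)"
    by (simp add: i integral_outer prob_space)
  also have "rtr (?P ** (W ** ?G)) = rtr (?G ** W)"
    by (metis matrix_mul_assoc rtr_mult_commute outer_proj(2))
  also have "rtr (?P ** (?G ** W)) = rtr (?G ** W)"
    by (simp add: matrix_mul_assoc outer_proj)
  finally show ?thesis
    by (simp add: dev_def matrix_diff_distrib rtr_diff algebra_simps)
qed

text \<open>Diagonal entries of an even power are squared column norms of the half power, so
  restricting the trace to \<open>S\<close> drops nonnegative terms.\<close>

lemma rtr_proj_le:
  assumes "hermitian A"
  shows "0 \<le> rtr (coord_proj S ** mpow A (2 * k))" "rtr (coord_proj S ** mpow A (2 * k)) \<le> rtr (mpow A (2 * k))"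
proof -
  have h: "hadj (mpow A k) = mpow A k" using hermitian_mpow[OF assms, of k] by (simp add: hermitian_def)
  have "Re (mpow A (2 * k) $ i $ i) = (\<Sum>j\<in>UNIV. (norm (mpow A k $ j $ i))\<^sup>2)" for i
  proof -
    have "mpow A (2 * k) = hadj (mpow A k) ** mpow A k" by (simp add: h mult_2 mpow_add)
    then show ?thesis
      by (simp add: hadj_def matrix_matrix_mult_def cmod_power2 flip: power2_eq_square)
  qed
  then have nn: "0 \<le> Re (mpow A (2 * k) $ i $ i)" for i by (simp add: sum_nonneg)
  have "rtr (coord_proj S ** mpow A (2 * k)) = (\<Sum>i\<in>UNIV. if i \<in> S then Re (mpow A (2 * k) $ i $ i) else 0)"
    by (simp add: rtr_def trace_def coord_proj_mult if_distrib[of Re] cong: if_cong)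
  then show "0 \<le> rtr (coord_proj S ** mpow A (2 * k))" "rtr (coord_proj S ** mpow A (2 * k)) \<le> rtr (mpow A (2 * k))"
    using nn by (auto simp: rtr_def trace_def intro!: sum_nonneg sum_mono)
qed

text \<open>
  The exchangeable pair \<open>(A, B)\<close> replaces one sample by an independent copy. The summands have rank
  one, so the conditional variance is affine in \<open>dev (a q)\<close>, and summing over \<open>q\<close> yields a closed
  recursion for the trace moments.
\<close>

lemma exchange_one:
  fixes q :: "'n::finite" and k :: nat
  defines "P \<equiv> Pi\<^sub>M UNIV (\<lambda>_::'n. M)"
  shows "(\<integral>a. rtr (dev (a q) ** mpow (dev_sum a) (2 * k + 1)) \<partial>P) \<le> (2 * real k + 1) / 2 *
    (\<integral>a. (real (card S) - 2) * rtr (dev (a q) ** mpow (dev_sum a) (2 * k))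
       + 2 * (real (card S) - 1) * rtr (coord_proj S ** mpow (dev_sum a) (2 * k)) \<partial>P)"
proof -
  interpret pr: product_prob_space "\<lambda>_::'n. M" UNIV by unfold_locales
  interpret P: prob_space P unfolding P_def by unfold_locales
  interpret PM: pair_prob_space P M by unfold_locales
  let ?N = "P \<Otimes>\<^sub>M M" and ?p = "2 * k + 1"
  define g where "g = (\<lambda>z::('n \<Rightarrow> 'a) \<times> 'a. ((fst z)(q := snd z), fst z q))"
  have g: "g \<in> measurable ?N ?N" and gd: "distr ?N ?N g = ?N"
    using swap_coordinate_distr[of q] by (simp_all add: P_def g_def)
  define X where "X z = dev (fst z q)" for z :: "('n \<Rightarrow> 'a) \<times> 'a"
  define Y where "Y z = dev (snd z)" for z :: "('n \<Rightarrow> 'a) \<times> 'a"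
  define A where "A z = dev_sum (fst z)" for z :: "('n \<Rightarrow> 'a) \<times> 'a"
  define B where "B z = dev_sum (fst (g z))" for z :: "('n \<Rightarrow> 'a) \<times> 'a"
  have sw: "X (g z) = Y z" "Y (g z) = X z" "A (g z) = B z" for z
    by (simp_all add: X_def Y_def A_def B_def g_def)
  have AB: "A z - B z = X z - Y z" for z
  proof -
    have "B z = dev (snd z) + (\<Sum>i\<in>UNIV - {q}. dev (fst z i))"
      unfolding B_def dev_sum_def g_def by (subst sum.remove[of _ q]) auto
    moreover have "A z = dev (fst z q) + (\<Sum>i\<in>UNIV - {q}. dev (fst z i))"
      unfolding A_def dev_sum_def by (subst sum.remove[of _ q]) auto
    ultimately show ?thesis by (simp add: X_def Y_def)
  qed
  have bm: "mat_bm ?N X" "mat_bm ?N Y" "mat_bm ?N A" "mat_bm ?N B"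
  proof -
    show "mat_bm ?N X" unfolding X_def P_def by (intro mat_bm_compose[OF mat_bm_dev]) measurable
    show "mat_bm ?N Y" unfolding Y_def P_def by (intro mat_bm_compose[OF mat_bm_dev]) measurable
    show A: "mat_bm ?N A" unfolding A_def P_def by (intro mat_bm_compose[OF mat_bm_dev_sum]) measurable
    then show "mat_bm ?N B"
      using mat_bm_compose[OF A g] by (simp add: sw)
  qed
  note bmi = mat_bm_mult mat_bm_mpow mat_bm_diff bm
  have int: "integrable ?N (\<lambda>z. rtr (F z))" if "mat_bm ?N F" for F
    using that by (rule PM.mat_bm_integrable)
  have swap: "(\<integral>z. rtr (F (g z)) \<partial>?N) = (\<integral>z. rtr (F z) \<partial>?N)" if "mat_bm ?N F" for F
    using integral_distr[OF g mat_bm_rtr_measurable[OF that]] by (simp add: gd)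
  have fubini: "(\<integral>z. rtr (F z) \<partial>?N) = (\<integral>a. \<integral>u. rtr (F (a, u)) \<partial>M \<partial>P)" if "mat_bm ?N F" for F
    using PM.integral_fst'[OF int[OF that]] by simp
  define h where "h = (\<integral>z. rtr (X z ** mpow (A z) ?p) \<partial>?N)"
  have h: "h = (\<integral>a. rtr (dev (a q) ** mpow (dev_sum a) ?p) \<partial>P)"
    unfolding h_def fubini[of "\<lambda>z. X z ** mpow (A z) ?p", OF mat_bm_mult[OF bm(1) mat_bm_mpow[OF bm(3)]]]
    by (simp add: X_def A_def prob_space del: mpow.simps)
  \<comment> \<open>\<open>Y\<close> comes from the fresh sample, hence is centred and independent
    of \<open>A\<close>; the swap carries this over to \<open>X\<close> against
    \<open>B\<close>.\<close>
  have "(\<integral>z. rtr (Y z ** mpow (A z) ?p) \<partial>?N) = 0"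
    unfolding fubini[of "\<lambda>z. Y z ** mpow (A z) ?p", OF mat_bm_mult[OF bm(2) mat_bm_mpow[OF bm(3)]]]
    by (simp add: Y_def A_def integral_dev del: mpow.simps)
  moreover have "(\<integral>z. rtr (Y z ** mpow (A z) ?p) \<partial>?N) = (\<integral>z. rtr (X z ** mpow (B z) ?p) \<partial>?N)"
    using swap[of "\<lambda>z. Y z ** mpow (A z) ?p", OF mat_bm_mult[OF bm(2) mat_bm_mpow[OF bm(3)]]]
    by (simp add: sw del: mpow.simps)
  moreover have "h = (\<integral>z. rtr (Y z ** mpow (B z) ?p) \<partial>?N)"
    unfolding h_def
    using swap[of "\<lambda>z. X z ** mpow (A z) ?p", OF mat_bm_mult[OF bm(1) mat_bm_mpow[OF bm(3)]]]
    by (simp add: sw del: mpow.simps)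
  \<comment> \<open>Of the four products the two mixed ones integrate to 0 and the other two to
    \<open>h\<close>.\<close>
  moreover have "(\<integral>z. rtr ((A z - B z) ** (mpow (A z) ?p - mpow (B z) ?p)) \<partial>?N) =
      h - (\<integral>z. rtr (Y z ** mpow (A z) ?p) \<partial>?N)
       - ((\<integral>z. rtr (X z ** mpow (B z) ?p) \<partial>?N) - (\<integral>z. rtr (Y z ** mpow (B z) ?p) \<partial>?N))"
    unfolding AB h_def
    by (simp add: matrix_diff_distrib rtr_diff int bmi del: mpow.simps)
  ultimately have "2 * h = (\<integral>z. rtr ((A z - B z) ** (mpow (A z) ?p - mpow (B z) ?p)) \<partial>?N)"
    by simp
  also have "\<dots> \<le> (\<integral>z. (2 * real k + 1) / 2 * (rtr ((A z - B z) ** (A z - B z) ** mpow (A z) (2 * k))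
        + rtr ((A z - B z) ** (A z - B z) ** mpow (B z) (2 * k))) \<partial>?N)"
    by (intro integral_mono int rtr_diff_mpow_le integrable_mult_right Bochner_Integration.integrable_add bmi)
      (simp_all add: A_def B_def hermitian_dev_sum)
  also have "\<dots> = (2 * real k + 1) / 2 * ((\<integral>z. rtr ((X z - Y z) ** (X z - Y z) ** mpow (A z) (2 * k)) \<partial>?N)
        + (\<integral>z. rtr ((X z - Y z) ** (X z - Y z) ** mpow (B z) (2 * k)) \<partial>?N))"
    unfolding AB by (simp add: int bmi)
  \<comment> \<open>The swap exchanges \<open>A\<close> with \<open>B\<close> and merely flips the
    sign of \<open>X - Y\<close>, which is squared.\<close>
  also have "(\<integral>z. rtr ((X z - Y z) ** (X z - Y z) ** mpow (B z) (2 * k)) \<partial>?N) =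
      (\<integral>z. rtr ((X z - Y z) ** (X z - Y z) ** mpow (A z) (2 * k)) \<partial>?N)"
  proof -
    have "(Y z - X z) ** (Y z - X z) = (X z - Y z) ** (X z - Y z)" for z
      by (simp add: matrix_diff_distrib)
    moreover have "mat_bm ?N (\<lambda>z. (X z - Y z) ** (X z - Y z) ** mpow (A z) (2 * k))" by (intro bmi)
    ultimately show ?thesis
      using swap[of "\<lambda>z. (X z - Y z) ** (X z - Y z) ** mpow (A z) (2 * k)"] by (simp add: sw)
  qed
  also have "(\<integral>z. rtr ((X z - Y z) ** (X z - Y z) ** mpow (A z) (2 * k)) \<partial>?N) =
      (\<integral>a. (real (card S) - 2) * rtr (dev (a q) ** mpow (dev_sum a) (2 * k))
       + 2 * (real (card S) - 1) * rtr (coord_proj S ** mpow (dev_sum a) (2 * k)) \<partial>P)"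
  proof -
    have "mat_bm ?N (\<lambda>z. (X z - Y z) ** (X z - Y z) ** mpow (A z) (2 * k))" by (intro bmi)
    from fubini[OF this] show ?thesis by (simp add: X_def Y_def A_def integral_dev_diff_square)
  qed
  finally show ?thesis unfolding h by simp
qed

text \<open>Summing \<open>exchange_one\<close> over the samples turns the \<open>dev\<close> term
  into an odd trace moment, which is then split between the moments \<open>Suc k\<close> and
  \<open>k\<close>.\<close>

lemma trace_moment_Suc_le:
  fixes s :: real and n :: "'n::finite itself"
  assumes s: "s \<ge> 2" "real (card S) \<le> s" and k: "(2 * real k + 1) * s \<le> real CARD('n) / 2"
  shows "trace_moment n (Suc k) \<le> (2 * real k + 1) * (3 / 2 * s * real CARD('n)) * trace_moment n k"
proof -
  interpret pr: product_prob_space "\<lambda>_::'n. M" UNIV by unfold_locales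
  define P where "P = Pi\<^sub>M UNIV (\<lambda>_::'n. M)"
  interpret P: prob_space P unfolding P_def by unfold_locales
  let ?n = "real CARD('n)" and ?d = "real (card S)"
  \<comment> \<open>Chosen so that the moment \<open>Suc k\<close> returns on the right with
    coefficient exactly 1/4 and can be moved to the left.\<close>
  define c where "c = 1 / ((2 * real k + 1) * s)"
  have c: "c > 0" using s by (simp add: c_def)
  have A: "mat_bm P (dev_sum :: ('n \<Rightarrow> 'a) \<Rightarrow> _)" unfolding P_def by (rule mat_bm_dev_sum)
  have D: "mat_bm P (\<lambda>a. dev (a q))" for q :: 'n
    unfolding P_def by (intro mat_bm_compose[OF mat_bm_dev]) measurable
  note bmi = mat_bm_mult mat_bm_mpow mat_bm_const A D
  note int = P.mat_bm_integrable
  have tm: "trace_moment n j = (\<integral>a. rtr (mpow (dev_sum a) (2 * j)) \<partial>P)" for j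
    by (simp add: trace_moment_def P_def)
  have tm0: "0 \<le> trace_moment n k"
    unfolding tm by (intro Bochner_Integration.integral_nonneg) (simp add: rtr_mpow_even_nonneg hermitian_dev_sum)
  have "trace_moment n (Suc k) = (\<integral>a. (\<Sum>q\<in>UNIV. rtr (dev (a q) ** mpow (dev_sum a) (2 * k + 1))) \<partial>P)"
  proof -
    have "rtr (mpow (dev_sum a) (2 * Suc k)) = (\<Sum>q\<in>UNIV. rtr (dev (a q) ** mpow (dev_sum a) (2 * k + 1)))"
      for a :: "'n \<Rightarrow> 'a"
    proof -
      have "mpow (dev_sum a) (2 * Suc k) = dev_sum a ** mpow (dev_sum a) (2 * k + 1)" by simp
      also have "\<dots> = (\<Sum>q\<in>UNIV. dev (a q) ** mpow (dev_sum a) (2 * k + 1))"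
        by (subst (1) dev_sum_def) (rule matrix_sum_distrib_right)
      finally show ?thesis by (simp only: rtr_sum)
    qed
    then show ?thesis by (simp only: tm)
  qed
  also have "\<dots> = (\<Sum>q\<in>UNIV. \<integral>a. rtr (dev (a q) ** mpow (dev_sum a) (2 * k + 1)) \<partial>P)"
    by (intro Bochner_Integration.integral_sum int bmi)
  also have "\<dots> \<le> (\<Sum>q\<in>(UNIV :: 'n set). (2 * real k + 1) / 2 *
      (\<integral>a. (?d - 2) * rtr (dev (a q) ** mpow (dev_sum a) (2 * k))
       + 2 * (?d - 1) * rtr (coord_proj S ** mpow (dev_sum a) (2 * k)) \<partial>P))"
    unfolding P_def by (intro sum_mono exchange_one)
  also have "\<dots> = (2 * real k + 1) / 2 *
      (\<integral>a. (\<Sum>q\<in>UNIV. (?d - 2) * rtr (dev (a q) ** mpow (dev_sum a) (2 * k))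
       + 2 * (?d - 1) * rtr (coord_proj S ** mpow (dev_sum a) (2 * k))) \<partial>P)"
    by (subst Bochner_Integration.integral_sum)
      (auto simp: sum_distrib_left intro!: int bmi Bochner_Integration.integrable_add integrable_mult_right)
  also have "\<dots> \<le> (2 * real k + 1) / 2 *
      (\<integral>a. s / 2 * (c * rtr (mpow (dev_sum a) (2 * Suc k)) + rtr (mpow (dev_sum a) (2 * k)) / c)
        + 2 * s * ?n * rtr (mpow (dev_sum a) (2 * k)) \<partial>P)"
  proof (intro mult_left_mono integral_mono)
    show "integrable P (\<lambda>a. \<Sum>q\<in>UNIV. (?d - 2) * rtr (dev (a q) ** mpow (dev_sum a) (2 * k))
       + 2 * (?d - 1) * rtr (coord_proj S ** mpow (dev_sum a) (2 * k)))"
      by (intro Bochner_Integration.integrable_sum int bmi Bochner_Integration.integrable_add integrable_mult_right)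
    show "integrable P (\<lambda>a. s / 2 * (c * rtr (mpow (dev_sum a) (2 * Suc k)) + rtr (mpow (dev_sum a) (2 * k)) / c)
        + 2 * s * ?n * rtr (mpow (dev_sum a) (2 * k)))"
      by (intro int bmi Bochner_Integration.integrable_add integrable_mult_right integrable_divide)
    fix a :: "'n \<Rightarrow> 'a"
    let ?A = "dev_sum a"
    have H: "hermitian ?A" by (rule hermitian_dev_sum)
    have "(\<Sum>q\<in>UNIV. rtr (dev (a q) ** mpow ?A (2 * k))) = rtr (mpow ?A (2 * k + 1))"
    proof -
      have "mpow ?A (2 * k + 1) = ?A ** mpow ?A (2 * k)" by simp
      also have "\<dots> = (\<Sum>q\<in>UNIV. dev (a q) ** mpow ?A (2 * k))"
        by (subst (1) dev_sum_def) (rule matrix_sum_distrib_right)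
      finally show ?thesis by (simp only: rtr_sum)
    qed
    then have "(\<Sum>q\<in>UNIV. (?d - 2) * rtr (dev (a q) ** mpow ?A (2 * k))
       + 2 * (?d - 1) * rtr (coord_proj S ** mpow ?A (2 * k)))
      = (?d - 2) * rtr (mpow ?A (2 * k + 1)) + ?n * (2 * (?d - 1) * rtr (coord_proj S ** mpow ?A (2 * k)))"
      by (simp add: sum.distrib sum_distrib_left[symmetric])
    also have "(?d - 2) * rtr (mpow ?A (2 * k + 1)) \<le> \<bar>?d - 2\<bar> * \<bar>rtr (mpow ?A (2 * k + 1))\<bar>"
      by (metis abs_ge_self abs_mult)
    \<comment> \<open>For \<open>card S\<close> equal to 0 or 1 the difference is negative;
      \<open>s \<ge> 2\<close> covers its absolute value.\<close>
    also have "\<dots> \<le> s * \<bar>rtr (mpow ?A (2 * k + 1))\<bar>"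
      by (rule mult_right_mono) (use s in auto)
    also have "\<dots> = s / 2 * (2 * \<bar>rtr (mpow ?A (2 * k + 1))\<bar>)" by simp
    also have "\<dots> \<le> s / 2 * (c * rtr (mpow ?A (2 * Suc k)) + rtr (mpow ?A (2 * k)) / c)"
      using rtr_mpow_odd_le[OF H c, of k] s by (intro mult_left_mono) auto
    also have "2 * (?d - 1) * rtr (coord_proj S ** mpow ?A (2 * k)) \<le> 2 * s * rtr (mpow ?A (2 * k))"
    proof -
      have "2 * (?d - 1) * rtr (coord_proj S ** mpow ?A (2 * k)) \<le> 2 * s * rtr (coord_proj S ** mpow ?A (2 * k))"
        using rtr_proj_le(1)[OF H, of k] s by (intro mult_right_mono) auto
      also have "\<dots> \<le> 2 * s * rtr (mpow ?A (2 * k))"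
        using rtr_proj_le(2)[OF H, of k] s by (intro mult_left_mono) auto
      finally show ?thesis .
    qed
    finally show "(\<Sum>q\<in>UNIV. (?d - 2) * rtr (dev (a q) ** mpow ?A (2 * k))
       + 2 * (?d - 1) * rtr (coord_proj S ** mpow ?A (2 * k)))
      \<le> s / 2 * (c * rtr (mpow ?A (2 * Suc k)) + rtr (mpow ?A (2 * k)) / c)
        + 2 * s * ?n * rtr (mpow ?A (2 * k))"
      by (simp add: mult_left_mono algebra_simps)
  qed simp
  also have "\<dots> = (2 * real k + 1) / 2 *
      (s / 2 * (c * trace_moment n (Suc k) + trace_moment n k / c) + 2 * s * ?n * trace_moment n k)"
  proof -
    have "integrable P (\<lambda>a. rtr (mpow (dev_sum a) j))" for j by (intro int bmi)
    then show ?thesis unfolding tm by (simp del: mpow.simps mult_Suc_right)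
  qed
  also have "\<dots> = trace_moment n (Suc k) / 4
      + (2 * real k + 1) * s * ((2 * real k + 1) * s / 4 + ?n) * trace_moment n k"
  proof -
    define w where "w = (2 * real k + 1) * s"
    have "w > 0" using s by (simp add: w_def)
    have "(2 * real k + 1) / 2 * (s / 2 * X + 2 * s * ?n * trace_moment n k)
        = w / 4 * X + w * ?n * trace_moment n k" for X
      by (simp add: w_def algebra_simps add_divide_distrib)
    note eq = this[of "c * trace_moment n (Suc k) + trace_moment n k / c"]
    show ?thesis
      using \<open>w > 0\<close> unfolding eq unfolding c_def w_def[symmetric] by (simp add: field_simps)
  qed
  finally have "3 / 4 * trace_moment n (Suc k)
      \<le> (2 * real k + 1) * s * ((2 * real k + 1) * s / 4 + ?n) * trace_moment n k" by simp
  \<comment> \<open>Dividing 9/8 by the 3/4 left after absorption gives the factor 3/2 of the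
    statement.\<close>
  also have "\<dots> \<le> (2 * real k + 1) * s * (9 / 8 * ?n) * trace_moment n k"
  proof -
    have "(2 * real k + 1) * s / 4 + ?n \<le> 9 / 8 * ?n" using k by linarith
    then show ?thesis using s tm0 by (intro mult_right_mono mult_left_mono) auto
  qed
  finally show ?thesis by (simp add: algebra_simps)
qed

text \<open>The recursion starts at the trace of the identity, which gives the dimension factor. The
  bound on \<open>R\<close> keeps every step below \<open>R\<close> within its range of
  validity.\<close>

lemma trace_moment_le:
  fixes s :: real and n :: "'n::finite itself"
  assumes s: "s \<ge> 2" "real (card S) \<le> s" and R: "4 * real R * s \<le> real CARD('n)"
  shows "trace_moment n R \<le> real CARD('m) * (3 / 2 * s * real CARD('n) * real R) ^ R"
proof -
  interpret pr: product_prob_space "\<lambda>_::'n. M" UNIV by unfold_locales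
  let ?c = "3 / 2 * s * real CARD('n)"
  have "trace_moment n j \<le> real CARD('m) * (\<Prod>i<j. 2 * real i + 1) * ?c ^ j" if "j \<le> R" for j
    using that
  proof (induction j)
    case 0
    show ?case by (simp add: trace_moment_def rtr_def trace_I pr.prob_space)
  next
    case (Suc j)
    have "(2 * real j + 1) * s \<le> 2 * real R * s" by (rule mult_right_mono) (use Suc.prems s in auto)
    then have "(2 * real j + 1) * s \<le> real CARD('n) / 2" using R by simp
    from trace_moment_Suc_le[OF s this, of n]
    have "trace_moment n (Suc j) \<le> (2 * real j + 1) * ?c * trace_moment n j" .
    also have "\<dots> \<le> (2 * real j + 1) * ?c * (real CARD('m) * (\<Prod>i<j. 2 * real i + 1) * ?c ^ j)"
      using Suc s by (intro mult_left_mono) auto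
    also have "\<dots> = real CARD('m) * (\<Prod>i<Suc j. 2 * real i + 1) * ?c ^ Suc j"
      by simp
    finally show ?case .
  qed
  from this[of R] have "trace_moment n R \<le> real CARD('m) * (\<Prod>i<R. 2 * real i + 1) * ?c ^ R" by simp
  also have "\<dots> \<le> real CARD('m) * real R ^ R * ?c ^ R"
    using prod_odd_le[of R] s by (intro mult_right_mono mult_left_mono) auto
  also have "\<dots> = real CARD('m) * (?c * real R) ^ R"
    unfolding power_mult_distrib[of ?c "real R"] by (simp only: mult.assoc mult.commute[of "real R ^ R"])
  finally show ?thesis .
qed

lemma prob_trace_large:
  fixes s t :: real
  defines "P \<equiv> Pi\<^sub>M UNIV (\<lambda>_::'n::finite. M)"
  assumes s: "s \<ge> 2" "real (card S) \<le> s" and R: "4 * real R * s \<le> real CARD('n)" and t: "t > 0"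
  shows "measure P {a \<in> space P. t ^ (2 * R) \<le> rtr (mpow (dev_sum a) (2 * R))}
    \<le> real CARD('m) * (3 / 2 * s * real CARD('n) * real R / t\<^sup>2) ^ R"
proof -
  interpret pr: product_prob_space "\<lambda>_::'n. M" UNIV by unfold_locales
  interpret P: prob_space P unfolding P_def by unfold_locales
  have "integrable P (\<lambda>a. rtr (mpow (dev_sum a) (2 * R)))"
    unfolding P_def by (intro pr.mat_bm_integrable mat_bm_mpow mat_bm_dev_sum)
  then have "measure P {a \<in> space P. t ^ (2 * R) \<le> rtr (mpow (dev_sum a) (2 * R))}
      \<le> (\<integral>a. rtr (mpow (dev_sum a) (2 * R)) \<partial>P) / t ^ (2 * R)"
    by (intro integral_Markov_inequality_measure[where A = "space P"])
      (use t in \<open>auto simp: rtr_mpow_even_nonneg hermitian_dev_sum\<close>)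
  also have "(\<integral>a. rtr (mpow (dev_sum a) (2 * R)) \<partial>P) = trace_moment TYPE('n) R"
    by (simp add: trace_moment_def P_def)
  also have "\<dots> / t ^ (2 * R) \<le> real CARD('m) * (3 / 2 * s * real CARD('n) * real R) ^ R / t ^ (2 * R)"
    by (rule divide_right_mono[OF trace_moment_le[OF s R]]) (use t in simp)
  finally show ?thesis by (simp add: power_divide power_mult)
qed

end

section \<open>Steinhaus sums\<close>

lemma choose_mult_fact_le: "j \<le> r \<Longrightarrow> real (r choose j) * fact (r - j) \<le> fact r"
proof -
  assume j: "j \<le> r"
  have "(r choose j) * fact (r - j) * 1 \<le> (r choose j) * fact (r - j) * (fact j :: nat)"
    by (intro mult_left_mono) (simp_all add: fact_ge_1)
  also have "\<dots> = fact r"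
    using binomial_fact_lemma[OF j] by (simp add: mult_ac)
  finally have "real ((r choose j) * fact (r - j)) \<le> real (fact r)" by (simp only: mult_1_right of_nat_le_iff)
  then show ?thesis by simp
qed

text \<open>\<open>g\<close> has the uniform law on the unit circle, expressed through its moments.
  This form fits both random phases and characters evaluated at random sensors.\<close>

locale steinhaus = prob_space +
  fixes g :: "'a \<Rightarrow> complex"
  assumes g_measurable: "g \<in> borel_measurable M"
    and g_norm: "\<And>w. norm (g w) = 1"
    and g_power: "\<And>j. j \<ge> 1 \<Longrightarrow> expectation (\<lambda>w. g w ^ j) = 0"
begin

lemma bm_g: "bounded_measurable M g"
  unfolding bounded_measurable_def using g_measurable g_norm by (metis order_refl)

lemma bm_g_power: "bounded_measurable M (\<lambda>w. g w ^ j)"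
  by (induction j) (simp_all add: bm_const bm_mult bm_g)

lemma integral_g_power_cnj:
  "expectation (\<lambda>w. g w ^ j * cnj (g w ^ k)) = (if j = k then 1 else 0)"
proof -
  have u: "g w ^ i * cnj (g w ^ i) = 1" for w i
    by (simp only: complex_norm_square[symmetric] norm_power g_norm) simp
  have "g w ^ j * cnj (g w ^ k) = (if k \<le> j then g w ^ (j - k) else cnj (g w ^ (k - j)))" for w
  proof (cases "k \<le> j")
    case True
    then have "g w ^ j = g w ^ (j - k) * g w ^ k" by (simp flip: power_add)
    then show ?thesis using True u[of w k] by (simp add: mult.assoc)
  next
    case False
    then have "g w ^ k = g w ^ j * g w ^ (k - j)" by (simp flip: power_add)
    then show ?thesis using False u[of w j] by (simp flip: mult.assoc)
  qed
  moreover have "expectation (\<lambda>w. cnj (g w ^ i)) = cnj (expectation (\<lambda>w. g w ^ i))" for i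
    by (rule Bochner_Integration.integral_cnj)
  ultimately show ?thesis using g_power[of "j - k"] g_power[of "k - j"]
    by (cases j k rule: linorder_cases) (simp_all add: prob_space)
qed

text \<open>Expand the \<open>r\<close>-th power binomially and take the squared modulus: distinct
  powers of \<open>g\<close> are orthonormal, so only diagonal terms survive.\<close>

lemma integral_norm_affine_power:
  "expectation (\<lambda>w. norm (z + c * g w) ^ (2 * r))
    = (\<Sum>j\<le>r. (real (r choose j))\<^sup>2 * norm c ^ (2 * j) * norm z ^ (2 * (r - j)))"
proof -
  define t where "t j = of_nat (r choose j) * c ^ j * z ^ (r - j)" for j
  have int: "integrable M (\<lambda>w. g w ^ j * cnj (g w ^ k))" for j k
    by (intro bm_integrable bm_mult bm_cnj bm_g_power)
  have "complex_of_real (norm (z + c * g w) ^ (2 * r))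
      = (\<Sum>j\<le>r. \<Sum>k\<le>r. t j * cnj (t k) * (g w ^ j * cnj (g w ^ k)))" for w
  proof -
    have e: "(z + c * g w) ^ r = (\<Sum>j\<le>r. t j * g w ^ j)"
      unfolding add.commute[of z] binomial_ring by (simp add: t_def power_mult_distrib mult_ac)
    have "complex_of_real (norm (z + c * g w) ^ (2 * r)) = complex_of_real ((norm ((z + c * g w) ^ r))\<^sup>2)"
      by (simp add: norm_power power_mult[symmetric] mult.commute)
    also have "\<dots> = (z + c * g w) ^ r * cnj ((z + c * g w) ^ r)"
      by (rule complex_norm_square)
    also have "\<dots> = (\<Sum>j\<le>r. \<Sum>k\<le>r. (t j * g w ^ j) * cnj (t k * g w ^ k))"
      unfolding e cnj_sum sum_product ..
    finally show ?thesis by (simp add: mult_ac)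
  qed
  then have "complex_of_real (expectation (\<lambda>w. norm (z + c * g w) ^ (2 * r)))
      = expectation (\<lambda>w. \<Sum>j\<le>r. \<Sum>k\<le>r. t j * cnj (t k) * (g w ^ j * cnj (g w ^ k)))"
    by (simp flip: integral_complex_of_real)
  also have "\<dots> = (\<Sum>j\<le>r. \<Sum>k\<le>r. t j * cnj (t k) * expectation (\<lambda>w. g w ^ j * cnj (g w ^ k)))"
    using int by (simp add: Bochner_Integration.integral_sum)
  also have "\<dots> = (\<Sum>j\<le>r. t j * cnj (t j))"
    unfolding integral_g_power_cnj by (simp add: if_distrib[of "\<lambda>x. _ * x"] cong: if_cong)
  also have "\<dots> = complex_of_real (\<Sum>j\<le>r. (norm (t j))\<^sup>2)"
    unfolding of_real_sum by (simp only: complex_norm_square)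
  finally have "expectation (\<lambda>w. norm (z + c * g w) ^ (2 * r)) = (\<Sum>j\<le>r. (norm (t j))\<^sup>2)"
    by (simp only: of_real_eq_iff)
  then show ?thesis
    by (simp add: t_def norm_mult norm_power power_mult_distrib power_mult[symmetric] mult.commute)
qed

text \<open>The right-hand side is the moment of a complex Gaussian variable of the same variance.\<close>

lemma steinhaus_moment_le:
  fixes c :: "'i \<Rightarrow> complex"
  assumes "finite I"
  shows "(\<integral>x. norm (\<Sum>i\<in>I. c i * g (x i)) ^ (2 * r) \<partial>Pi\<^sub>M I (\<lambda>_. M))
    \<le> fact r * (\<Sum>i\<in>I. (norm (c i))\<^sup>2) ^ r"
  using assms
proof (induction I arbitrary: r rule: finite_induct)
  case empty
  interpret pr: product_prob_space "\<lambda>_::'i. M" "{}" by unfold_locales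
  show ?case by (cases r) (simp_all add: pr.prob_space)
next
  case (insert i I)
  interpret pr: product_prob_space "\<lambda>_::'i. M" I by unfold_locales
  let ?Z = "\<lambda>I x. \<Sum>i\<in>I. c i * g (x i)"
  let ?V = "\<Sum>i\<in>I. (norm (c i))\<^sup>2"
  have int: "integrable (Pi\<^sub>M J (\<lambda>_. M)) (\<lambda>x. norm (?Z J x) ^ k)" if "finite J" for J k
  proof -
    interpret prJ: product_prob_space "\<lambda>_::'i. M" J by unfold_locales
    show ?thesis
    proof (rule prJ.integrable_const_bound[where B = "(\<Sum>i\<in>J. norm (c i)) ^ k"])
      have "norm (?Z J x) \<le> (\<Sum>i\<in>J. norm (c i))" for x
        by (rule sum_norm_le) (simp add: norm_mult g_norm)
      then show "AE x in Pi\<^sub>M J (\<lambda>_. M). norm (norm (?Z J x) ^ k) \<le> (\<Sum>i\<in>J. norm (c i)) ^ k"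
        by (intro AE_I2) (simp add: power_mono)
      have "(\<lambda>x. g (x i)) \<in> borel_measurable (Pi\<^sub>M J (\<lambda>_. M))" if "i \<in> J" for i
        using measurable_compose[OF measurable_component_singleton[OF that] g_measurable] .
      then show "(\<lambda>x. norm (?Z J x) ^ k) \<in> borel_measurable (Pi\<^sub>M J (\<lambda>_. M))"
        by (intro borel_measurable_power borel_measurable_norm borel_measurable_sum borel_measurable_times) auto
    qed
  qed
  have "(\<integral>x. norm (?Z (insert i I) x) ^ (2 * r) \<partial>Pi\<^sub>M (insert i I) (\<lambda>_. M))
      = (\<integral>x. \<integral>y. norm (?Z (insert i I) (x(i := y))) ^ (2 * r) \<partial>M \<partial>Pi\<^sub>M I (\<lambda>_. M))"
    by (rule pr.product_integral_insert[OF insert(1,2) int]) (use insert in simp)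
  also have "\<dots> = (\<integral>x. \<integral>y. norm (?Z I x + c i * g y) ^ (2 * r) \<partial>M \<partial>Pi\<^sub>M I (\<lambda>_. M))"
  proof -
    have "?Z (insert i I) (x(i := y)) = ?Z I x + c i * g y" for x y
    proof -
      have "?Z I (x(i := y)) = ?Z I x" using insert(2) by (intro sum.cong) auto
      then show ?thesis using insert(1,2) by (simp add: add.commute)
    qed
    then show ?thesis by simp
  qed
  also have "\<dots> = (\<integral>x. (\<Sum>j\<le>r. (real (r choose j))\<^sup>2 * norm (c i) ^ (2 * j) * norm (?Z I x) ^ (2 * (r - j))) \<partial>Pi\<^sub>M I (\<lambda>_. M))"
    by (simp only: integral_norm_affine_power)
  also have "\<dots> = (\<Sum>j\<le>r. (real (r choose j))\<^sup>2 * norm (c i) ^ (2 * j) *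
      (\<integral>x. norm (?Z I x) ^ (2 * (r - j)) \<partial>Pi\<^sub>M I (\<lambda>_. M)))"
    using int[OF insert(1)] by (simp add: Bochner_Integration.integral_sum)
  \<comment> \<open>One binomial coefficient is absorbed into \<open>fact r\<close>; the other
    rebuilds the binomial theorem for the enlarged variance.\<close>
  also have "\<dots> \<le> (\<Sum>j\<le>r. fact r * (real (r choose j) * ((norm (c i))\<^sup>2) ^ j * ?V ^ (r - j)))"
  proof (rule sum_mono)
    fix j assume "j \<in> {..r}"
    then have j: "j \<le> r" by simp
    have "(real (r choose j))\<^sup>2 * norm (c i) ^ (2 * j) * (\<integral>x. norm (?Z I x) ^ (2 * (r - j)) \<partial>Pi\<^sub>M I (\<lambda>_. M))
        \<le> (real (r choose j))\<^sup>2 * norm (c i) ^ (2 * j) * (fact (r - j) * ?V ^ (r - j))"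
      by (intro mult_left_mono insert) auto
    also have "\<dots> = (real (r choose j) * fact (r - j)) * (real (r choose j) * ((norm (c i))\<^sup>2) ^ j * ?V ^ (r - j))"
      unfolding power_mult power2_eq_square[of "real (r choose j)"] by (simp only: mult_ac)
    also have "\<dots> \<le> fact r * (real (r choose j) * ((norm (c i))\<^sup>2) ^ j * ?V ^ (r - j))"
      by (intro mult_right_mono choose_mult_fact_le[OF j]) (auto intro!: mult_nonneg_nonneg sum_nonneg zero_le_power)
    finally show "(real (r choose j))\<^sup>2 * norm (c i) ^ (2 * j) * (\<integral>x. norm (?Z I x) ^ (2 * (r - j)) \<partial>Pi\<^sub>M I (\<lambda>_. M))
        \<le> fact r * (real (r choose j) * ((norm (c i))\<^sup>2) ^ j * ?V ^ (r - j))" .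
  qed
  also have "\<dots> = fact r * ((norm (c i))\<^sup>2 + ?V) ^ r"
    by (simp only: binomial_ring sum_distrib_left)
  finally show ?case using insert(1,2) by simp
qed

text \<open>Markov for the \<open>2 * r\<close>-th power, with \<open>fact r\<close> bounded by
  \<open>r ^ r\<close> so that everything becomes a single power. The order \<open>r\<close> is
  fixed by each application.\<close>

lemma steinhaus_tail:
  fixes c :: "'i \<Rightarrow> complex"
  assumes I: "finite I" and t: "t > 0"
  shows "measure (Pi\<^sub>M I (\<lambda>_. M)) {x \<in> space (Pi\<^sub>M I (\<lambda>_. M)). t \<le> norm (\<Sum>i\<in>I. c i * g (x i))}
    \<le> (real r * (\<Sum>i\<in>I. (norm (c i))\<^sup>2) / t\<^sup>2) ^ r"
proof -
  interpret pr: product_prob_space "\<lambda>_::'i. M" I by unfold_locales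
  let ?P = "Pi\<^sub>M I (\<lambda>_. M)" and ?Z = "\<lambda>x. \<Sum>i\<in>I. c i * g (x i)" and ?V = "\<Sum>i\<in>I. (norm (c i))\<^sup>2"
  have [measurable]: "(\<lambda>x. g (x i)) \<in> borel_measurable ?P" if "i \<in> I" for i
    using measurable_compose[OF measurable_component_singleton[OF that] g_measurable] .
  have Zm[measurable]: "?Z \<in> borel_measurable ?P"
    by (intro borel_measurable_sum borel_measurable_times) auto
  have "integrable ?P (\<lambda>x. norm (?Z x) ^ (2 * r))"
  proof (rule pr.integrable_const_bound[where B = "(\<Sum>i\<in>I. norm (c i)) ^ (2 * r)"])
    have "norm (?Z x) \<le> (\<Sum>i\<in>I. norm (c i))" for x
      by (rule sum_norm_le) (simp add: norm_mult g_norm)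
    then show "AE x in ?P. norm (norm (?Z x) ^ (2 * r)) \<le> (\<Sum>i\<in>I. norm (c i)) ^ (2 * r)"
      by (intro AE_I2) (simp add: power_mono)
  qed measurable
  then have "measure ?P {x \<in> space ?P. t ^ (2 * r) \<le> norm (?Z x) ^ (2 * r)}
      \<le> (\<integral>x. norm (?Z x) ^ (2 * r) \<partial>?P) / t ^ (2 * r)"
    by (intro integral_Markov_inequality_measure[where A = "space ?P"]) (use t in auto)
  also have "\<dots> \<le> (fact r * ?V ^ r) / t ^ (2 * r)"
    by (rule divide_right_mono[OF steinhaus_moment_le[OF I]]) (use t in simp)
  also have "\<dots> \<le> (real r ^ r * ?V ^ r) / t ^ (2 * r)"
    using fact_le_power[of r, where 'a = real] t
    by (intro divide_right_mono mult_right_mono) (auto intro!: zero_le_power sum_nonneg)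
  also have "\<dots> = (real r * ?V / t\<^sup>2) ^ r"
    by (simp add: power_divide power_mult_distrib power_mult)
  finally have "measure ?P {x \<in> space ?P. t ^ (2 * r) \<le> norm (?Z x) ^ (2 * r)} \<le> (real r * ?V / t\<^sup>2) ^ r" .
  moreover have "measure ?P {x \<in> space ?P. t \<le> norm (?Z x)}
      \<le> measure ?P {x \<in> space ?P. t ^ (2 * r) \<le> norm (?Z x) ^ (2 * r)}"
    by (intro pr.finite_measure_mono) (use t in \<open>auto intro: power_mono\<close>)
  ultimately show ?thesis by linarith
qed

end

section \<open>Characters under uniform laws\<close>

lemma integral_uniform_measure:
  fixes h :: "'a \<Rightarrow> complex"
  assumes A: "A \<in> sets N" "emeasure N A \<noteq> 0" "emeasure N A \<noteq> \<infinity>" and h: "h \<in> borel_measurable N"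
  shows "(\<integral>x. h x \<partial>uniform_measure N A) = (\<integral>x. indicator A x *\<^sub>R h x \<partial>N) / of_real (measure N A)"
proof -
  have m: "emeasure N A = ennreal (measure N A)" "measure N A > 0"
  proof -
    show m1: "emeasure N A = ennreal (measure N A)"
      using A(3) by (intro emeasure_eq_ennreal_measure) simp
    have "measure N A \<noteq> 0" using A(2) m1 by (metis ennreal_0)
    then show "measure N A > 0" using measure_nonneg[of N A] by linarith
  qed
  have "uniform_measure N A = density N (\<lambda>x. ennreal (indicator A x / measure N A))"
    unfolding uniform_measure_def m(1)
    by (intro density_cong) (use A m in \<open>auto simp: divide_ennreal[symmetric] ennreal_indicator\<close>)
  then have "(\<integral>x. h x \<partial>uniform_measure N A) = (\<integral>x. (indicator A x / measure N A) *\<^sub>R h x \<partial>N)"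
    using A h by (subst integral_density[symmetric]) auto
  also have "\<dots> = (\<integral>x. (1 / measure N A) *\<^sub>R (indicator A x *\<^sub>R h x) \<partial>N)" by simp
  also have "\<dots> = (\<integral>x. indicator A x *\<^sub>R h x \<partial>N) / of_real (measure N A)"
    by (subst integral_scaleR_right) (simp add: scaleR_conv_of_real field_simps)
  finally show ?thesis .
qed

text \<open>The frequency is an integer number of periods per length \<open>A\<close>, so the
  primitive takes equal values at both ends.\<close>

lemma integral_cis_interval:
  assumes A: "A > 0" and j: "j \<noteq> (0::int)"
  shows "(\<integral>x. indicator {0..A} x *\<^sub>R cis (2 * pi * of_int j * x / A) \<partial>lborel) = 0"
proof -
  define b where "b = 2 * pi * of_int j / A"
  have b: "b \<noteq> 0" using A j by (simp add: b_def)
  define F where "F x = cis (b * x) / (\<i> * of_real b)" for x :: real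
  have "(F has_vector_derivative cis (b * x)) (at x within {0..A})" for x
  proof -
    have "((\<lambda>x. exp (\<i> * of_real b * of_real x) / (\<i> * of_real b)) has_vector_derivative
        exp (\<i> * of_real b * of_real x)) (at x within {0..A})"
      by (rule has_vector_derivative_real_field) (use b in \<open>auto intro!: derivative_eq_intros\<close>)
    then show ?thesis by (simp add: F_def[abs_def] cis_conv_exp mult.assoc)
  qed
  moreover have "continuous_on {0..A} (\<lambda>x. cis (b * x))"
    unfolding cis_conv_exp by (intro continuous_intros)
  ultimately have "(\<integral>x. indicator {0..A} x *\<^sub>R cis (b * x) \<partial>lborel) = F A - F 0"
    using A by (intro integral_FTC_atLeastAtMost) auto
  also have "F A = F 0"
    using A cis_multiple_2pi[of "of_int j"] by (simp add: F_def b_def mult_ac)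
  finally show ?thesis by (simp add: b_def field_simps)
qed

lemma uniform_interval_cis:
  assumes A: "A > 0" and j: "j \<noteq> (0::int)"
  shows "(\<integral>x. cis (2 * pi * of_int j * x / A) \<partial>uniform_measure lborel {0..A}) = 0"
proof -
  have "(\<lambda>x. cis (2 * pi * of_int j * x / A)) \<in> borel_measurable lborel"
    unfolding cis_conv_exp by measurable
  then show ?thesis
    using A by (subst integral_uniform_measure) (simp_all add: integral_cis_interval[OF A j])
qed

lemma uniform_square_cis:
  assumes A: "A > 0" and jk: "j \<noteq> (0::int) \<or> k \<noteq> (0::int)"
  shows "(\<integral>u. cis (2 * pi * (of_int j * fst u + of_int k * snd u) / A)
     \<partial>uniform_measure lborel ({0..A} \<times> {0..A})) = 0"
proof -
  let ?c = "\<lambda>j x. indicator {0..A} x *\<^sub>R cis (2 * pi * of_int j * x / A) :: complex"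
  have m: "(\<lambda>u. cis (2 * pi * (of_int j * fst u + of_int k * snd u) / A)) \<in> borel_measurable lborel"
  proof -
    have "(\<lambda>u. cis (2 * pi * (of_int j * fst u + of_int k * snd u) / A)) \<in> borel_measurable borel"
      unfolding cis_conv_exp using A by (intro borel_measurable_continuous_onI continuous_intros) auto
    then show ?thesis by simp
  qed
  have sq: "emeasure lborel ({0..A} \<times> {0..A}) = ennreal (A * A)"
    unfolding lborel_prod[symmetric] using A
    by (subst lborel.emeasure_pair_measure_Times) (simp_all add: ennreal_mult)
  have ci: "integrable lborel (?c j)" for j
  proof (rule borel_integrable_compact[where S = "{0..A}" and f = "\<lambda>x. cis (2 * pi * of_int j * x / A)", simplified])
    show "continuous_on {0..A} (\<lambda>x. cis (2 * pi * of_int j * x / A))"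
      unfolding cis_conv_exp by (intro continuous_intros) (use A in auto)
  qed
  have "indicator ({0..A} \<times> {0..A}) u *\<^sub>R cis (2 * pi * (of_int j * fst u + of_int k * snd u) / A)
      = ?c j (fst u) * ?c k (snd u)" for u :: "real \<times> real"
    by (cases u) (auto simp: indicator_def cis_mult add_divide_distrib[symmetric] ring_distribs mult_ac)
  then have "(\<integral>u. indicator ({0..A} \<times> {0..A}) u *\<^sub>R cis (2 * pi * (of_int j * fst u + of_int k * snd u) / A) \<partial>lborel)
      = (\<integral>u. ?c j (fst u) * ?c k (snd u) \<partial>(lborel \<Otimes>\<^sub>M lborel))"
    by (simp add: lborel_prod)
  also have "\<dots> = (\<integral>x. \<integral>y. ?c j x * ?c k y \<partial>lborel \<partial>lborel)"
  proof -
    have cm: "?c j \<in> borel_measurable lborel" for j using ci by (rule borel_measurable_integrable)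
    have "(\<lambda>u. ?c j (fst u) * ?c k (snd u)) \<in> borel_measurable (lborel \<Otimes>\<^sub>M lborel)"
      by (intro borel_measurable_times measurable_compose[OF measurable_fst cm] measurable_compose[OF measurable_snd cm])
    moreover have "integrable lborel (\<lambda>x. \<integral>y. norm (?c j x * ?c k y) \<partial>lborel)"
      unfolding norm_mult using integrable_norm[OF ci[of j]] by simp
    moreover have "integrable lborel (\<lambda>y. ?c j x * ?c k y)" for x
      using ci by (intro integrable_mult_right)
    ultimately have "integrable (lborel \<Otimes>\<^sub>M lborel) (\<lambda>u. ?c j (fst u) * ?c k (snd u))"
      by (intro lborel_pair.Fubini_integrable) simp_all
    from lborel_pair.integral_fst'[OF this] show ?thesis by simp
  qed
  also have "\<dots> = (\<integral>x. ?c j x \<partial>lborel) * (\<integral>y. ?c k y \<partial>lborel)"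
    by (simp only: integral_mult_right_zero integral_mult_left_zero)
  also have "\<dots> = 0" using jk integral_cis_interval[OF A] by auto
  finally show ?thesis
    using A m closed_Times[of "{0..A}" "{0..A}"]
    by (subst integral_uniform_measure) (simp_all add: sq borel_closed)
qed

section \<open>Exact recovery\<close>

text \<open>Feasible vectors are exactly the translates of \<open>X\<close> by kernel
  vectors.\<close>

lemma BP_recovers_iff:
  "BP_recovers \<Phi> X \<longleftrightarrow> (\<forall>h. \<Phi> *v h = 0 \<and> h \<noteq> 0 \<longrightarrow> l1_norm X < l1_norm (X + h))"
proof
  assume r: "BP_recovers \<Phi> X"
  show "\<forall>h. \<Phi> *v h = 0 \<and> h \<noteq> 0 \<longrightarrow> l1_norm X < l1_norm (X + h)"
  proof (intro allI impI, rule ccontr)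
    fix h assume h: "\<Phi> *v h = 0 \<and> h \<noteq> 0" "\<not> l1_norm X < l1_norm (X + h)"
    have "X \<in> BP_solutions \<Phi> (\<Phi> *v X)" using r by (simp add: BP_recovers_def)
    with h have "X + h \<in> BP_solutions \<Phi> (\<Phi> *v X)"
      by (auto simp: BP_solutions_def is_arg_min_def matrix_vector_right_distrib not_less intro: order_trans)
    with r h(1) show False by (simp add: BP_recovers_def)
  qed
next
  assume l: "\<forall>h. \<Phi> *v h = 0 \<and> h \<noteq> 0 \<longrightarrow> l1_norm X < l1_norm (X + h)"
  have lt: "l1_norm X < l1_norm Z" if "\<Phi> *v Z = \<Phi> *v X" "Z \<noteq> X" for Z
    using l[rule_format, of "Z - X"] that by (simp add: matrix_vector_mult_diff_distrib)
  have "Z \<in> BP_solutions \<Phi> (\<Phi> *v X) \<longleftrightarrow> Z = X" for Z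
    using lt by (auto simp: BP_solutions_def is_arg_min_def) (metis less_asym)
  then show "BP_recovers \<Phi> X" by (auto simp: BP_recovers_def)
qed

lemma sum_UNIV_split: "sum F UNIV = sum F S + sum F (- S)" for S :: "'m::finite set"
  using sum.union_disjoint[of S "- S" F] by (simp add: Compl_partition)

lemma gram_kernel: "\<Phi> *v h = 0 \<Longrightarrow> (hadj \<Phi> ** \<Phi>) *v h = 0"
  by (simp add: matrix_vector_mul_assoc[symmetric])

definition supported_on :: "'m set \<Rightarrow> complex ^ 'm \<Rightarrow> bool" where
  "supported_on S x \<longleftrightarrow> (\<forall>i. i \<notin> S \<longrightarrow> x $ i = 0)"

lemma coord_proj_vector: "(coord_proj S *v x) $ i = (if i \<in> S then x $ i else 0)"
proof -
  have "(coord_proj S *v x) $ i = (\<Sum>k\<in>UNIV. if k = i then (if i \<in> S then x $ i else 0) else 0)"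
    unfolding matrix_vector_mult_def coord_proj_def vec_lambda_beta by (rule sum.cong) auto
  then show ?thesis by simp
qed

lemma compressed_gram_vector:
  assumes "supported_on S x"
  shows "((coord_proj S ** G ** coord_proj S - coord_proj S) *v x) $ i =
    (if i \<in> S then (G *v x) $ i - x $ i else 0)"
proof -
  have "coord_proj S *v x = x" using assms[unfolded supported_on_def] by (simp add: vec_eq_iff coord_proj_vector)
  then show ?thesis
    using assms by (simp add: matrix_vector_mult_diff_rdistrib matrix_vector_mul_assoc[symmetric]
        coord_proj_vector supported_on_def)
qed

text \<open>\<open>c\<close> solves the least squares problem of representing column
  \<open>j\<close> by the columns in \<open>S\<close>. The perturbation bound 1/4 bounds the inverse
  of the Gram block by 4/3, whose square is the 16/9.\<close>

lemma dual_vector_exists: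
  fixes G :: "complex ^ 'm ^ 'm"
  assumes H: "\<And>x. norm ((coord_proj S ** G ** coord_proj S - coord_proj S) *v x) \<le> 1 / 4 * norm x"
    and coh: "\<And>i. i \<in> S \<Longrightarrow> (norm (G $ i $ j))\<^sup>2 \<le> b"
  obtains c where "supported_on S c" "\<And>i. i \<in> S \<Longrightarrow> (G *v c) $ i = G $ i $ j"
    "(\<Sum>i\<in>S. (norm (c $ i))\<^sup>2) \<le> 16 / 9 * real (card S) * b"
proof -
  let ?H = "coord_proj S ** G ** coord_proj S - coord_proj S"
  \<comment> \<open>\<open>K\<close> is the Gram block on \<open>S\<close> extended by the identity
    off \<open>S\<close>. Inverting it on the whole space therefore gives a solution supported on
    \<open>S\<close>.\<close>
  define K where "K x = x + ?H *v x" for x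
  have lin: "linear K"
  proof (rule linearI)
    have "?H *v (r *\<^sub>R x) = r *\<^sub>R (?H *v x)" for r x
      by (simp only: vec_eq_iff matrix_vector_mult_def vec_lambda_beta vector_scaleR_component
          scaleR_sum_right mult_scaleR_right) simp
    then show "K (r *\<^sub>R x) = r *\<^sub>R K x" for r x
      by (simp only: K_def scaleR_right_distrib)
    show "K (x + y) = K x + K y" for x y
      by (simp only: K_def matrix_vector_right_distrib add_ac)
  qed
  have "inj K"
  proof (rule linear_injective_0[OF lin, THEN iffD2], intro allI impI)
    fix x assume "K x = 0"
    then have "?H *v x = - x" unfolding K_def by (metis add_eq_0_iff)
    with H[of x] show "x = 0" by simp
  qed
  then have "surj K" by (rule linear_inj_imp_surj[OF lin])
  define v where "v = (\<chi> i. if i \<in> S then G $ i $ j else 0)"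
  obtain c where c: "K c = v" using \<open>surj K\<close> by (metis surjD)
  have out: "c $ i = 0" if "i \<notin> S" for i
  proof -
    have "(?H *v c) $ i = 0"
      using that by (simp add: matrix_vector_mult_diff_rdistrib matrix_vector_mul_assoc[symmetric] coord_proj_vector)
    then have "K c $ i = c $ i" by (simp add: K_def)
    then show ?thesis using c that by (simp add: v_def)
  qed
  then have sup: "supported_on S c" by (simp add: supported_on_def)
  have inn: "(G *v c) $ i = G $ i $ j" if "i \<in> S" for i
  proof -
    have "K c $ i = (G *v c) $ i" unfolding K_def vector_add_component compressed_gram_vector[OF sup] using that by simp
    then show ?thesis using c that by (simp add: v_def)
  qed
  have "norm c \<le> norm v + 1 / 4 * norm c"
  proof -
    have "c = v - ?H *v c" using c unfolding K_def by (rule eq_diff_eq[THEN iffD2])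
    then have "norm c \<le> norm v + norm (?H *v c)" by (metis norm_triangle_ineq4)
    then show ?thesis using H[of c] by simp
  qed
  then have "norm c \<le> 4 / 3 * norm v" by simp
  then have "(norm c)\<^sup>2 \<le> (4 / 3 * norm v)\<^sup>2" by (rule power_mono) simp
  then have "(norm c)\<^sup>2 \<le> 16 / 9 * (norm v)\<^sup>2" by (simp add: power2_eq_square)
  also have "(norm v)\<^sup>2 = (\<Sum>i\<in>UNIV. if i \<in> S then (norm (G $ i $ j))\<^sup>2 else 0)"
    unfolding norm_vec_def L2_set_def by (simp add: sum_nonneg v_def) (rule sum.cong, auto)
  also have "\<dots> = (\<Sum>i\<in>S. (norm (G $ i $ j))\<^sup>2)" by (simp add: sum.If_cases)
  also have "\<dots> \<le> (\<Sum>i\<in>S. b)" by (rule sum_mono) (rule coh)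
  finally have "(norm c)\<^sup>2 \<le> 16 / 9 * real (card S) * b" by simp
  moreover have "(\<Sum>i\<in>S. (norm (c $ i))\<^sup>2) \<le> (norm c)\<^sup>2"
    by (simp add: norm_vec_def L2_set_def sum_nonneg) (rule sum_mono2, auto)
  ultimately show ?thesis using sup inn that by (meson order_trans)
qed

text \<open>The subgradient inequality of the modulus: rotating by the unit number
  \<open>cnj (sgn x)\<close> makes \<open>x\<close> real, and real parts are at most moduli.\<close>

lemma norm_add_ge_sgn: "norm (x :: complex) + Re (h * cnj (sgn x)) \<le> norm (x + h)" if "x \<noteq> 0"
proof -
  have "x * cnj (sgn x) = complex_of_real (norm x)"
    using that complex_norm_square[of x]
    by (simp add: sgn_div_norm scaleR_conv_of_real divide_simps power2_eq_square)
  then have "norm x + Re (h * cnj (sgn x)) = Re ((x + h) * cnj (sgn x))"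
    by (simp add: distrib_right)
  also have "\<dots> \<le> norm ((x + h) * cnj (sgn x))" by (rule complex_Re_le_cmod)
  also have "\<dots> = norm (x + h)" using that by (simp add: norm_mult norm_sgn)
  finally show ?thesis .
qed

text \<open>
  On \<open>S\<close> a kernel vector satisfies \<open>h i = - (\<Sum>j\<in>-S. h j * c j i)\<close>, so its effect on the norm there is
  dominated by its entries off \<open>S\<close>.
\<close>

lemma BP_recovers_dual:
  fixes \<Phi> :: "complex ^ 'm ^ 'n" and c :: "'m \<Rightarrow> complex ^ 'm"
  defines "G \<equiv> hadj \<Phi> ** \<Phi>"
  assumes H: "\<And>x. norm ((coord_proj S ** G ** coord_proj S - coord_proj S) *v x) \<le> 1 / 4 * norm x"
    and X: "support X = S"
    and c: "\<And>j. j \<notin> S \<Longrightarrow> supported_on S (c j)"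
      "\<And>i j. j \<notin> S \<Longrightarrow> i \<in> S \<Longrightarrow> (G *v c j) $ i = G $ i $ j"
    and lt: "\<And>j. j \<notin> S \<Longrightarrow> norm (\<Sum>i\<in>S. cnj (c j $ i) * sgn (X $ i)) < 1"
  shows "BP_recovers \<Phi> X"
  unfolding BP_recovers_iff
proof (intro allI impI, elim conjE)
  fix h assume ker: "\<Phi> *v h = 0" and h0: "h \<noteq> 0"
  have Gh: "G *v h = 0" using gram_kernel[OF ker] by (simp add: G_def)
  \<comment> \<open>Replaces each column off \<open>S\<close> by its representation on
    \<open>S\<close>. Then \<open>G *v d\<close> agrees with \<open>G *v h\<close> on
    \<open>S\<close>, so it vanishes there, and the contraction bound forces
    \<open>d = 0\<close>.\<close>
  define d where "d = coord_proj S *v h + (\<Sum>j\<in>-S. h $ j *s c j)"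
  have dsup: "supported_on S d"
    using c(1) by (auto simp: supported_on_def d_def coord_proj_vector)
  have lin: "G *v (\<Sum>j\<in>J. h $ j *s c j) = (\<Sum>j\<in>J. h $ j *s (G *v c j))" for J
    by (induction J rule: infinite_finite_induct)
      (simp_all add: matrix_vector_right_distrib vector_scalar_commute)
  have "(G *v d) $ i = 0" if i: "i \<in> S" for i
  proof -
    have "(G *v d) $ i = (G *v (coord_proj S *v h)) $ i + (\<Sum>j\<in>-S. h $ j * (G *v c j) $ i)"
      unfolding d_def matrix_vector_right_distrib vector_add_component lin
      by (simp only: sum_component vector_smult_component)
    also have "(\<Sum>j\<in>-S. h $ j * (G *v c j) $ i) = (\<Sum>j\<in>-S. G $ i $ j * h $ j)"
      by (rule sum.cong) (use c(2) i in \<open>auto simp: mult.commute\<close>)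
    also have "(G *v (coord_proj S *v h)) $ i = (\<Sum>j\<in>UNIV. if j \<in> S then G $ i $ j * h $ j else 0)"
      by (subst matrix_vector_mult_def) (auto simp: coord_proj_vector intro!: sum.cong)
    also have "\<dots> = (\<Sum>j\<in>S. G $ i $ j * h $ j)" by (simp add: sum.If_cases)
    also have "(\<Sum>j\<in>S. G $ i $ j * h $ j) + (\<Sum>j\<in>-S. G $ i $ j * h $ j) = (\<Sum>j\<in>UNIV. G $ i $ j * h $ j)"
      by (rule sum_UNIV_split[symmetric])
    also have "\<dots> = (G *v h) $ i" by (simp add: matrix_vector_mult_def)
    finally show ?thesis by (simp add: Gh)
  qed
  then have "(coord_proj S ** G ** coord_proj S - coord_proj S) *v d = - d"
    using dsup by (auto simp: vec_eq_iff compressed_gram_vector[OF dsup] supported_on_def)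
  with H[of d] have d0: "d = 0" by simp
  have hS: "h $ i = - (\<Sum>j\<in>-S. h $ j * c j $ i)" if "i \<in> S" for i
  proof -
    have "d $ i = h $ i + (\<Sum>j\<in>-S. h $ j * c j $ i)"
      using that by (simp add: d_def coord_proj_vector)
    then show ?thesis using d0 by (simp add: add_eq_0_iff2)
  qed
  \<comment> \<open>Strictness needs a nonzero entry off \<open>S\<close>; without one the formula
    for \<open>h\<close> on \<open>S\<close> would give \<open>h = 0\<close>.\<close>
  have "\<exists>j0. j0 \<notin> S \<and> h $ j0 \<noteq> 0"
  proof (rule ccontr)
    assume "\<not> (\<exists>j0. j0 \<notin> S \<and> h $ j0 \<noteq> 0)"
    then have "h $ i = 0" for i using hS[of i] by (cases "i \<in> S") (auto intro!: sum.neutral)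
    then show False using h0 by (simp add: vec_eq_iff)
  qed
  then obtain j0 where j0: "j0 \<notin> S" "h $ j0 \<noteq> 0" by blast
  define \<kappa> where "\<kappa> j = norm (\<Sum>i\<in>S. cnj (c j $ i) * sgn (X $ i))" for j
  have "(\<Sum>i\<in>S. Re (h $ i * cnj (sgn (X $ i)))) = - (\<Sum>j\<in>-S. Re (h $ j * (\<Sum>i\<in>S. c j $ i * cnj (sgn (X $ i)))))"
  proof -
    have "(\<Sum>i\<in>S. h $ i * cnj (sgn (X $ i))) = (\<Sum>i\<in>S. - (\<Sum>j\<in>-S. h $ j * c j $ i) * cnj (sgn (X $ i)))"
      by (rule sum.cong) (use hS in auto)
    also have "\<dots> = - (\<Sum>i\<in>S. \<Sum>j\<in>-S. h $ j * (c j $ i * cnj (sgn (X $ i))))"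
      by (simp add: sum_distrib_right sum_negf mult.assoc)
    also have "\<dots> = - (\<Sum>j\<in>-S. h $ j * (\<Sum>i\<in>S. c j $ i * cnj (sgn (X $ i))))"
      by (subst sum.swap) (simp add: sum_distrib_left)
    finally have "Re (\<Sum>i\<in>S. h $ i * cnj (sgn (X $ i)))
        = Re (- (\<Sum>j\<in>-S. h $ j * (\<Sum>i\<in>S. c j $ i * cnj (sgn (X $ i)))))" by (rule arg_cong)
    then show ?thesis by (simp only: Re_sum uminus_complex.sel)
  qed
  moreover have "(\<Sum>j\<in>-S. Re (h $ j * (\<Sum>i\<in>S. c j $ i * cnj (sgn (X $ i))))) \<le> (\<Sum>j\<in>-S. norm (h $ j) * \<kappa> j)"
  proof (rule sum_mono)
    fix j
    have "norm (\<Sum>i\<in>S. c j $ i * cnj (sgn (X $ i))) = \<kappa> j"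
    proof -
      have "(\<Sum>i\<in>S. c j $ i * cnj (sgn (X $ i))) = cnj (\<Sum>i\<in>S. cnj (c j $ i) * sgn (X $ i))" by simp
      then show ?thesis unfolding \<kappa>_def by (simp only: complex_mod_cnj)
    qed
    then show "Re (h $ j * (\<Sum>i\<in>S. c j $ i * cnj (sgn (X $ i)))) \<le> norm (h $ j) * \<kappa> j"
      using complex_Re_le_cmod[of "h $ j * (\<Sum>i\<in>S. c j $ i * cnj (sgn (X $ i)))"]
      by (simp only: norm_mult)
  qed
  moreover have "(\<Sum>j\<in>-S. norm (h $ j) * \<kappa> j) < (\<Sum>j\<in>-S. norm (h $ j))"
  proof (rule sum_strict_mono_ex1)
    show "\<forall>j\<in>-S. norm (h $ j) * \<kappa> j \<le> norm (h $ j)"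
    proof
      fix j assume "j \<in> -S"
      then have "\<kappa> j \<le> 1" using lt[of j] by (simp add: \<kappa>_def less_imp_le)
      then show "norm (h $ j) * \<kappa> j \<le> norm (h $ j)" by (intro mult_left_le) auto
    qed
    show "\<exists>j\<in>-S. norm (h $ j) * \<kappa> j < norm (h $ j)"
    proof
      show "norm (h $ j0) * \<kappa> j0 < norm (h $ j0)"
        using mult_strict_left_mono[OF lt[OF j0(1)], of "norm (h $ j0)"] j0(2)
        by (simp add: \<kappa>_def)
    qed (use j0 in simp)
  qed simp
  moreover have "(\<Sum>i\<in>S. norm (X $ i) + Re (h $ i * cnj (sgn (X $ i)))) \<le> (\<Sum>i\<in>S. norm (X $ i + h $ i))"
    by (intro sum_mono norm_add_ge_sgn) (use X in \<open>auto simp: support_def\<close>)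
  moreover have "l1_norm Z = (\<Sum>i\<in>S. norm (Z $ i)) + (\<Sum>i\<in>-S. norm (Z $ i))" for Z
    unfolding l1_norm_def by (rule sum_UNIV_split)
  moreover have "X $ i = 0" if "i \<in> -S" for i using X that by (auto simp: support_def)
  ultimately show "l1_norm X < l1_norm (X + h)"
    by (simp add: sum.distrib)
qed

lemma BP_recovers_card_1:
  fixes \<Phi> :: "complex ^ 'm ^ 'n"
  assumes "CARD('m) = 1" "\<Phi> $ q $ j \<noteq> 0"
  shows "BP_recovers \<Phi> X"
  unfolding BP_recovers_iff
proof (intro allI impI, elim conjE)
  fix h assume "\<Phi> *v h = 0" "h \<noteq> 0"
  obtain x :: 'm where "UNIV = {x}" using assms(1) by (metis card_1_singletonE)
  then have U: "UNIV = {j}" by (metis UNIV_I singletonD)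
  have "(\<Phi> *v h) $ q = \<Phi> $ q $ j * h $ j" unfolding matrix_vector_mult_def U by simp
  then have "h $ j = 0" using \<open>\<Phi> *v h = 0\<close> assms(2) by simp
  then have "h = 0" using U by (auto simp: vec_eq_iff)
  then show "l1_norm X < l1_norm (X + h)" using \<open>h \<noteq> 0\<close> by simp
qed

section \<open>Measurability of the recovery event\<close>

lemma continuous_on_matrix_vector_mult [continuous_intros]:
  fixes F :: "'a::topological_space \<Rightarrow> complex ^ 'm ^ 'n"
  assumes "continuous_on A F" "continuous_on A v"
  shows "continuous_on A (\<lambda>z. F z *v v z)"
  unfolding matrix_vector_mult_def using assms by (intro continuous_intros)

lemma continuous_on_l1_norm [continuous_intros]:
  "continuous_on A v \<Longrightarrow> continuous_on A (\<lambda>z. l1_norm (v z))"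
  unfolding l1_norm_def by (intro continuous_intros)

text \<open>Failure of recovery is witnessed by a kernel vector in one of countably many compact annuli.\<close>

lemma BP_recovers_borel:
  "{z :: (complex ^ 'm ^ 'n) \<times> (complex ^ 'm). BP_recovers (fst z) (snd z)} \<in> sets borel"
proof -
  define K where "K k = {h :: complex ^ 'm. 1 / (real k + 1) \<le> norm h \<and> norm h \<le> real k + 1}" for k :: nat
  define T where "T = {w :: (complex ^ 'm) \<times> ((complex ^ 'm ^ 'n) \<times> (complex ^ 'm)).
    fst (snd w) *v fst w = 0 \<and> l1_norm (snd (snd w) + fst w) \<le> l1_norm (snd (snd w))}"
  have "compact (K k)" for k
  proof -
    have "K k = cball 0 (real k + 1) \<inter> {h. 1 / (real k + 1) \<le> norm h}" by (auto simp: K_def)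
    moreover have "closed {h :: complex ^ 'm. 1 / (real k + 1) \<le> norm h}"
      by (intro closed_Collect_le continuous_intros)
    ultimately show ?thesis by (simp add: compact_Int_closed)
  qed
  moreover have "closed T"
    unfolding T_def by (intro closed_Collect_conj closed_Collect_eq closed_Collect_le continuous_intros)
  ultimately have "closed {z. \<exists>h. h \<in> K k \<and> (h, z) \<in> T}" for k
    by (rule closed_compact_projection)
  then have "(\<Union>k. {z. \<exists>h. h \<in> K k \<and> (h, z) \<in> T}) \<in> sets borel"
    by (intro sets.countable_UN) (auto intro: borel_closed)
  moreover have "(\<Union>k. {z. \<exists>h. h \<in> K k \<and> (h, z) \<in> T}) = - {z. BP_recovers (fst z) (snd z)}"
  proof -
    have "(\<exists>k. h \<in> K k) \<longleftrightarrow> h \<noteq> 0" for h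
    proof
      assume "h \<noteq> 0"
      obtain k where k: "max (norm h) (1 / norm h) \<le> real k" using real_arch_simple by blast
      have "1 / (real k + 1) \<le> norm h"
      proof -
        have "1 / norm h \<le> real k + 1" using k by simp
        then show ?thesis using \<open>h \<noteq> 0\<close> by (simp add: field_simps)
      qed
      then have "h \<in> K k" using k by (simp add: K_def)
      then show "\<exists>k. h \<in> K k" ..
    next
      assume "\<exists>k. h \<in> K k"
      then obtain k where "1 / (real k + 1) \<le> norm h" by (auto simp: K_def)
      then show "h \<noteq> 0" by (auto simp: field_simps)
    qed
    moreover have "(\<Union>k. {z. \<exists>h. h \<in> K k \<and> (h, z) \<in> T}) = {z. \<exists>h. (\<exists>k. h \<in> K k) \<and> (h, z) \<in> T}"
      by auto
    ultimately have "(\<Union>k. {z. \<exists>h. h \<in> K k \<and> (h, z) \<in> T}) = {z. \<exists>h. h \<noteq> 0 \<and> (h, z) \<in> T}"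
      by simp
    then show ?thesis by (auto simp: BP_recovers_iff T_def not_less)
  qed
  ultimately have "- {z :: (complex ^ 'm ^ 'n) \<times> (complex ^ 'm). BP_recovers (fst z) (snd z)} \<in> sets borel" by simp
  then have "- (- {z :: (complex ^ 'm ^ 'n) \<times> (complex ^ 'm). BP_recovers (fst z) (snd z)}) \<in> sets borel"
    by (rule borel_comp)
  then show ?thesis by simp
qed

section \<open>Random targets\<close>

lemma borel_measurable_Arg2pi: "Arg2pi \<in> borel_measurable borel"
  unfolding borel_measurable_iff_greater using open_Arg2pi2pi_gt by (auto intro: borel_open)

lemma borel_measurable_vec_nth: "(\<lambda>X :: complex ^ 'm. X $ j) \<in> borel_measurable borel"
  by (intro borel_measurable_continuous_onI continuous_intros)

lemma sgn_eq_cis_Arg2pi: "z \<noteq> 0 \<Longrightarrow> sgn z = cis (Arg2pi z)"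
  using Arg2pi_eq[of z] by (simp add: sgn_div_norm cis_conv_exp scaleR_conv_of_real field_simps)

abbreviation uniform_phase :: "real measure" where
  "uniform_phase \<equiv> uniform_measure lborel {0..2 * pi}"

lemma prob_space_uniform_phase: "prob_space uniform_phase"
  by (rule prob_space_uniform_measure) auto

lemma steinhaus_uniform_phase: "steinhaus uniform_phase cis"
proof -
  interpret prob_space uniform_phase by (rule prob_space_uniform_phase)
  show ?thesis
  proof
    show "cis \<in> borel_measurable uniform_phase"
      unfolding cis_conv_exp by measurable
    show "norm (cis w) = 1" for w by simp
    show "expectation (\<lambda>w. cis w ^ j) = 0" if "j \<ge> 1" for j
      using uniform_interval_cis[of "2 * pi" "int j"] that by (simp add: Complex.DeMoivre)
  qed
qed

text \<open>The definition of the ensemble prescribes probabilities of phase rectangles only.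
  Uniqueness of the product measure extends them to all measurable phase events.\<close>

lemma target_phase_law:
  fixes T :: "(complex ^ 'm::finite) measure"
  assumes T: "target_ensemble s T" and B: "B \<in> sets (Pi\<^sub>M S (\<lambda>_. uniform_phase))"
  shows "{X. support X = S \<and> (\<lambda>j\<in>S. Arg2pi (X $ j)) \<in> B} \<in> sets T"
    and "measure T {X. support X = S \<and> (\<lambda>j\<in>S. Arg2pi (X $ j)) \<in> B}
      = pmf (support_law s) S * measure (Pi\<^sub>M S (\<lambda>_. uniform_phase)) B"
proof -
  interpret T: prob_space T using T by (simp add: target_ensemble_def)
  have sets_T[measurable_cong]: "sets T = sets borel" using T by (simp add: target_ensemble_def)
  then have space_T: "space T = UNIV" using sets_eq_imp_space_eq by force
  interpret U: prob_space uniform_phase by (rule prob_space_uniform_phase)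
  interpret PU: product_prob_space "\<lambda>_::'m. uniform_phase" S by unfold_locales
  let ?P = "Pi\<^sub>M S (\<lambda>_. uniform_phase)" and ?p = "pmf (support_law s) S"
  let ?\<phi> = "\<lambda>X :: complex ^ 'm. \<lambda>j\<in>S. Arg2pi (X $ j)"
  define A where "A = {X :: complex ^ 'm. support X = S}"
  have [measurable]: "(\<lambda>X :: complex ^ 'm. X $ j) \<in> borel_measurable borel" for j
    by (rule borel_measurable_vec_nth)
  have [measurable]: "Arg2pi \<in> borel_measurable borel" by (rule borel_measurable_Arg2pi)
  have A: "A \<in> sets T"
  proof -
    have "A = (\<Inter>j. {X \<in> space borel. (X $ j \<noteq> 0) = (j \<in> S)})"
      by (auto simp: A_def support_def)
    also have "\<dots> \<in> sets borel" by measurable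
    finally show ?thesis by (simp add: sets_T)
  qed
  have \<phi>: "?\<phi> \<in> measurable T ?P"
    by (rule measurable_restrict) measurable
  have eq: "{X. support X = S \<and> ?\<phi> X \<in> B} = A \<inter> (?\<phi> -` B \<inter> space T)" for B
    by (auto simp: A_def space_T)
  show "{X. support X = S \<and> ?\<phi> X \<in> B} \<in> sets T"
    unfolding eq using A measurable_sets[OF \<phi> B] by blast
  have rect: "measure T (A \<inter> (?\<phi> -` (Pi\<^sub>E S C) \<inter> space T)) = ?p * (\<Prod>j\<in>S. measure uniform_phase (C j))"
    if "\<And>j. j \<in> S \<Longrightarrow> C j \<in> sets borel" for C
  proof -
    have "A \<inter> (?\<phi> -` (Pi\<^sub>E S C) \<inter> space T) = {X. support X = S \<and> (\<forall>j\<in>S. Arg2pi (X $ j) \<in> C j)}"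
      by (auto simp: A_def space_T restrict_PiE_iff)
    then show ?thesis using T that by (simp add: target_ensemble_def)
  qed
  have pA: "measure T A = ?p"
  proof -
    have "measure T A = ?p * (\<Prod>j\<in>S. measure uniform_phase UNIV)"
    proof -
      have "A \<inter> (?\<phi> -` (Pi\<^sub>E S (\<lambda>_. UNIV)) \<inter> space T) = A" by (auto simp: space_T)
      then show ?thesis using rect[of "\<lambda>_. UNIV"] by simp
    qed
    moreover have "measure uniform_phase UNIV = 1" using U.prob_space by simp
    ultimately show ?thesis by simp
  qed
  show "measure T {X. support X = S \<and> ?\<phi> X \<in> B} = ?p * measure ?P B"
  proof (cases "?p = 0")
    case True
    have "measure T {X. support X = S \<and> ?\<phi> X \<in> B} \<le> measure T A"
      unfolding eq using A by (intro T.finite_measure_mono) auto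
    then show ?thesis using pA True by (simp add: measure_le_0_iff)
  next
    case False
    then have p: "?p > 0" by (simp add: pmf_pos)
    \<comment> \<open>The law of the target conditioned on its support; this is why a support of
      probability 0 is treated separately.\<close>
    let ?N = "uniform_measure T A"
    interpret N: prob_space ?N
      by (rule prob_space_uniform_measure) (use A pA p in \<open>auto simp: T.emeasure_eq_measure\<close>)
    have \<phi>N: "?\<phi> \<in> measurable ?N ?P" using \<phi> by simp
    have N: "measure ?N E = measure T (A \<inter> E) / ?p" if "E \<in> sets T" for E
      using measure_uniform_measure[of T A E] A p pA that by (simp add: T.emeasure_eq_measure)
    have "distr ?N ?P ?\<phi> = ?P"
    proof (rule PU.PiM_eqI)
      fix C :: "'m \<Rightarrow> real set" assume C: "\<And>i. i \<in> S \<Longrightarrow> C i \<in> sets uniform_phase"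
      have CP: "Pi\<^sub>E S C \<in> sets ?P" using C by (intro sets_PiM_I_finite) auto
      have "emeasure (distr ?N ?P ?\<phi>) (Pi\<^sub>E S C) = emeasure ?N (?\<phi> -` (Pi\<^sub>E S C) \<inter> space T)"
        using emeasure_distr[OF \<phi>N CP] by simp
      also have "\<dots> = ennreal (measure T (A \<inter> (?\<phi> -` (Pi\<^sub>E S C) \<inter> space T)) / ?p)"
        unfolding N.emeasure_eq_measure using measurable_sets[OF \<phi> CP] by (simp add: N)
      also have "\<dots> = ennreal (\<Prod>j\<in>S. measure uniform_phase (C j))"
        using rect[of C] C p by simp
      also have "\<dots> = (\<Prod>j\<in>S. emeasure uniform_phase (C j))"
        by (simp add: U.emeasure_eq_measure prod_ennreal)
      finally show "emeasure (distr ?N ?P ?\<phi>) (Pi\<^sub>E S C) = (\<Prod>i\<in>S. emeasure uniform_phase (C i))" .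
    qed simp_all
    then have "measure ?P B = measure ?N (?\<phi> -` B \<inter> space T)"
      using measure_distr[OF \<phi>N B] by simp
    also have "\<dots> = measure T (A \<inter> (?\<phi> -` B \<inter> space T)) / ?p"
      by (rule N[OF measurable_sets[OF \<phi> B]])
    finally show ?thesis unfolding eq using p by simp
  qed
qed

text \<open>The dual condition sees a target only through its support and the phases there, so
  arbitrary magnitudes do no harm. What remains is a union bound over the columns off
  \<open>S\<close> of Steinhaus tails at threshold 1.\<close>

lemma target_dual_prob:
  fixes T :: "(complex ^ 'm::finite) measure" and c :: "'m \<Rightarrow> complex ^ 'm"
  assumes T: "target_ensemble s T"
    and v0: "v \<ge> 0"
    and v: "\<And>j. j \<notin> S \<Longrightarrow> (\<Sum>i\<in>S. (norm (c j $ i))\<^sup>2) \<le> v"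
  defines "good \<equiv> {X. support X = S \<and> (\<forall>j. j \<notin> S \<longrightarrow> norm (\<Sum>i\<in>S. cnj (c j $ i) * sgn (X $ i)) < 1)}"
  shows "good \<in> sets T"
    and "pmf (support_law s) S * (1 - real CARD('m) * (real r * v) ^ r) \<le> measure T good"
proof -
  interpret St: steinhaus uniform_phase cis by (rule steinhaus_uniform_phase)
  interpret PU: product_prob_space "\<lambda>_::'m. uniform_phase" S by unfold_locales
  let ?P = "Pi\<^sub>M S (\<lambda>_. uniform_phase)"
  define Z where "Z j \<theta> = (\<Sum>i\<in>S. cnj (c j $ i) * cis (\<theta> i))" for j and \<theta> :: "'m \<Rightarrow> real"
  define B where "B = {\<theta> \<in> space ?P. \<forall>j\<in>-S. norm (Z j \<theta>) < 1}"
  define bad where "bad j = {\<theta> \<in> space ?P. 1 \<le> norm (Z j \<theta>)}" for j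
  have Zm: "Z j \<in> borel_measurable ?P" for j
  proof -
    have "(\<lambda>\<theta>. cis (\<theta> i)) \<in> borel_measurable ?P" if "i \<in> S" for i
      using measurable_compose[OF measurable_component_singleton[OF that] St.g_measurable] .
    then show ?thesis unfolding Z_def by (intro borel_measurable_sum borel_measurable_times) auto
  qed
  have badm: "bad j \<in> sets ?P" for j unfolding bad_def using Zm[of j] by measurable
  have BU: "B = space ?P - (\<Union>j\<in>-S. bad j)" 
    unfolding B_def bad_def by (auto simp: not_le) (meson ComplI not_le)
  then have Bm: "B \<in> sets ?P" using badm by auto
  have "measure ?P (bad j) \<le> (real r * v) ^ r" if "j \<notin> S" for j
  proof -
    have "measure ?P (bad j) \<le> (real r * (\<Sum>i\<in>S. (norm (cnj (c j $ i)))\<^sup>2) / 1\<^sup>2) ^ r"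
      unfolding bad_def Z_def by (rule St.steinhaus_tail) auto
    also have "\<dots> \<le> (real r * v) ^ r"
      using v[OF that] by (intro power_mono) (auto intro!: mult_left_mono mult_nonneg_nonneg sum_nonneg)
    finally show ?thesis .
  qed
  then have "measure ?P (\<Union>j\<in>-S. bad j) \<le> (\<Sum>j\<in>-S. (real r * v) ^ r)"
    using badm by (intro order_trans[OF PU.finite_measure_subadditive_finite] sum_mono) auto
  also have "\<dots> \<le> real CARD('m) * (real r * v) ^ r"
    using v0 by (simp add: mult_right_mono card_mono)
  finally have "1 - real CARD('m) * (real r * v) ^ r \<le> measure ?P B"
    unfolding BU using badm by (subst PU.prob_compl) auto
  moreover have "good = {X. support X = S \<and> (\<lambda>j\<in>S. Arg2pi (X $ j)) \<in> B}"
  proof -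
    have "(\<lambda>j\<in>S. Arg2pi (X $ j)) \<in> B \<longleftrightarrow> (\<forall>j. j \<notin> S \<longrightarrow> norm (\<Sum>i\<in>S. cnj (c j $ i) * sgn (X $ i)) < 1)"
      if "support X = S" for X
    proof -
      have "Z j (\<lambda>j\<in>S. Arg2pi (X $ j)) = (\<Sum>i\<in>S. cnj (c j $ i) * sgn (X $ i))" for j
        unfolding Z_def using that by (intro sum.cong refl) (auto simp: support_def sgn_eq_cis_Arg2pi)
      moreover have "(\<lambda>j\<in>S. Arg2pi (X $ j)) \<in> space ?P" by (simp add: space_PiM)
      ultimately show ?thesis by (simp add: B_def Ball_def)
    qed
    then show ?thesis unfolding good_def by auto
  qed
  ultimately show "good \<in> sets T"
    "pmf (support_law s) S * (1 - real CARD('m) * (real r * v) ^ r) \<le> measure T good"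
    using target_phase_law[OF T Bm] by (auto intro: mult_left_mono)
qed

section \<open>Random sensors\<close>

lemma exp_m1_ge: "x \<le> (1 / 3 :: real) \<Longrightarrow> x \<le> exp (- 1)"
proof -
  assume "x \<le> 1 / 3"
  also have "1 / 3 \<le> inverse (exp (1 :: real))"
    using le_imp_inverse_le[OF exp_le exp_gt_zero] by (simp add: inverse_eq_divide)
  finally show ?thesis by (simp add: exp_minus)
qed

text \<open>Common form of all tail estimates: a base of at most 1/3, hence at most
  \<open>exp (- 1)\<close>, turns the moment order into the exponent.\<close>

lemma power_le_exp:
  fixes x :: real
  assumes "0 \<le> x" "x \<le> 1 / 3" "y \<le> real r"
  shows "x ^ r \<le> exp (- y)"
proof -
  have "x ^ r \<le> exp (- 1) ^ r" using assms exp_m1_ge by (intro power_mono) auto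
  also have "\<dots> = exp (- real r)" by (simp flip: exp_of_nat_mult)
  also have "\<dots> \<le> exp (- y)" using assms by simp
  finally show ?thesis .
qed

text \<open>\<open>g_cross\<close> at \<open>r = 1\<close> makes the restricted rows isotropic; for
  all \<open>r\<close> it makes products of two columns Steinhaus variables.\<close>

locale phase_system = prob_space +
  fixes g :: "'m::finite \<Rightarrow> 'a \<Rightarrow> complex"
  assumes g_meas: "\<And>j. g j \<in> borel_measurable M"
    and g_unit: "\<And>j w. norm (g j w) = 1"
    and g_cross: "\<And>i j r. i \<noteq> j \<Longrightarrow> r \<ge> 1 \<Longrightarrow> expectation (\<lambda>w. (cnj (g i w) * g j w) ^ r) = 0"
begin

text \<open>Conjugated so that \<open>outer (restricted S w)\<close> has the entries
  \<open>cnj (g i w) * g j w\<close> of \<open>gram\<close>.\<close>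

definition restricted :: "'m set \<Rightarrow> 'a \<Rightarrow> complex ^ 'm" where
  "restricted S w = (\<chi> j. if j \<in> S then cnj (g j w) else 0)"

definition gram :: "('n::finite \<Rightarrow> 'a) \<Rightarrow> complex ^ 'm ^ 'm" where
  "gram a = (\<chi> i j. (\<Sum>q\<in>UNIV. cnj (g i (a q)) * g j (a q)) / of_nat CARD('n))"

lemma cnj_g: "cnj (g i w) * g i w = 1"
  using complex_norm_square[of "g i w"] by (simp add: g_unit mult.commute)

lemma cnj_meas: "(\<lambda>w. cnj (g j w)) \<in> borel_measurable M"
  using g_meas by (intro borel_measurable_continuous_on[OF continuous_on_cnj[OF continuous_on_id]])

lemma isotropic_restricted: "isotropic M (restricted S) S"
proof
  show "(\<lambda>w. restricted S w $ j) \<in> borel_measurable M" for j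
    using cnj_meas by (simp add: restricted_def)
  show "norm (restricted S w $ j) = (if j \<in> S then 1 else 0)" for w j
    by (simp add: restricted_def g_unit)
  show "expectation (\<lambda>w. restricted S w $ i * cnj (restricted S w $ j)) = (if i = j \<and> i \<in> S then 1 else 0)" for i j
    using g_cross[of i j 1] by (cases "i = j"; cases "i \<in> S"; cases "j \<in> S") (simp_all add: restricted_def cnj_g prob_space)
qed

lemma steinhaus_cross: "i \<noteq> j \<Longrightarrow> steinhaus M (\<lambda>w. cnj (g i w) * g j w)"
  by unfold_locales
    (auto simp: norm_mult g_unit g_cross[simplified] intro: borel_measurable_times g_meas cnj_meas)

lemma compressed_gram:
  fixes a :: "'n::finite \<Rightarrow> 'a"
  shows "coord_proj S ** gram a ** coord_proj S - coord_proj S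
    = (1 / real CARD('n)) *\<^sub>R isotropic.dev_sum (restricted S) S a"
proof -
  interpret isotropic M "restricted S" S by (rule isotropic_restricted)
  have "(coord_proj S ** gram a ** coord_proj S - coord_proj S) $ i $ j
    = (1 / real CARD('n)) *\<^sub>R (dev_sum a $ i $ j)" for i j
  proof -
    have "dev_sum a $ i $ j = (\<Sum>q\<in>UNIV. restricted S (a q) $ i * cnj (restricted S (a q) $ j) - coord_proj S $ i $ j)"
      by (simp add: dev_sum_def dev_def outer_def)
    also have "\<dots> = (\<Sum>q\<in>UNIV. restricted S (a q) $ i * cnj (restricted S (a q) $ j)) - of_nat CARD('n) * coord_proj S $ i $ j"
      by (simp add: sum_subtractf)
    finally have "(1 / real CARD('n)) *\<^sub>R (dev_sum a $ i $ j) =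
        (\<Sum>q\<in>UNIV. restricted S (a q) $ i * cnj (restricted S (a q) $ j)) / of_nat CARD('n) - coord_proj S $ i $ j"
      by (simp add: scaleR_conv_of_real diff_divide_distrib)
    then show ?thesis
      by (auto simp: mult_coord_proj coord_proj_mult gram_def restricted_def)
  qed
  then show ?thesis by (simp add: vec_eq_iff)
qed

lemma good_sensors:
  fixes \<Lambda> L s :: real
  defines "P \<equiv> Pi\<^sub>M UNIV (\<lambda>_::'n::finite. M)"
  assumes \<Lambda>: "\<Lambda> \<ge> 8 / 3" and L: "L \<ge> 2" and s: "s \<ge> 2" "real (card S) \<le> s"
    and n: "64 * \<Lambda> * L * s \<le> real CARD('n)"
  obtains good where "good \<in> sets P"
    "1 - (real CARD('m))\<^sup>2 * exp (- 2 * \<Lambda>) - real CARD('m) * exp (- \<Lambda>) \<le> measure P good"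
    "\<And>a i j. a \<in> good \<Longrightarrow> i \<noteq> j \<Longrightarrow> (norm (gram a $ i $ j))\<^sup>2 \<le> 8 * \<Lambda> / real CARD('n)"
    "\<And>a x. a \<in> good \<Longrightarrow> norm ((coord_proj S ** gram a ** coord_proj S - coord_proj S) *v x) \<le> 1 / 4 * norm x"
proof -
  interpret isotropic M "restricted S" S by (rule isotropic_restricted)
  interpret pr: product_prob_space "\<lambda>_::'n. M" UNIV by unfold_locales
  interpret P: prob_space P unfolding P_def by unfold_locales
  let ?n = "real CARD('n)" and ?m = "real CARD('m)"
  have n0: "?n > 0" by simp
  \<comment> \<open>Order of the trace moment. As \<open>\<Lambda> \<ge> 8 / 3\<close>, rounding up
    costs at most the factor 11/8.\<close>
  define R where "R = nat \<lceil>\<Lambda>\<rceil>"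
  have R: "\<Lambda> \<le> real R" "real R \<le> 11 / 8 * \<Lambda>" "R \<ge> 1" using \<Lambda> unfolding R_def by linarith+
  \<comment> \<open>Order of the coherence moment: the exponent \<open>2 * \<Lambda>\<close> is
    needed against the union over up to \<open>m^2\<close> pairs of columns.\<close>
  define r where "r = nat \<lceil>2 * \<Lambda>\<rceil>"
  have r: "2 * \<Lambda> \<le> real r" "real r \<le> 19 / 8 * \<Lambda>" using \<Lambda> unfolding r_def by linarith+
  have \<Lambda>s: "128 * \<Lambda> * s \<le> ?n"
  proof -
    have "\<Lambda> * s * 2 \<le> \<Lambda> * s * L" using L \<Lambda> s by (intro mult_left_mono) auto
    then show ?thesis using n by (simp add: mult_ac)
  qed
  have Rs: "real R * s \<le> 11 / 8 * \<Lambda> * s" using R s by (intro mult_right_mono) auto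
  have "0 \<le> \<Lambda> * s" using \<Lambda> s by simp
  then have R4: "4 * real R * s \<le> ?n" and R24: "24 * (real R * s) \<le> 1 / 3 * ?n"
    using Rs \<Lambda>s by linarith+
  define B1 where "B1 = {a \<in> space P. (?n / 4) ^ (2 * R) \<le> rtr (mpow (dev_sum a) (2 * R))}"
  \<comment> \<open>The base of the tail is \<open>real r / (8 * \<Lambda>)\<close>, at most 19/64
    and so below 1/3.\<close>
  define t where "t = sqrt (8 * \<Lambda> * ?n)"
  have t: "t > 0" "t\<^sup>2 = 8 * \<Lambda> * ?n" using \<Lambda> n0 by (simp_all add: t_def)
  define B2 where "B2 i j = {a \<in> space P. t \<le> norm (\<Sum>q\<in>UNIV. 1 * (cnj (g i (a q)) * g j (a q)))}" for i j
  have B1m: "B1 \<in> sets P"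
  proof -
    have "mat_bm P (\<lambda>a. mpow (dev_sum a) (2 * R))"
      unfolding P_def by (intro mat_bm_mpow mat_bm_dev_sum)
    from mat_bm_rtr_measurable[OF this] show ?thesis unfolding B1_def by measurable
  qed
  have B2m: "B2 i j \<in> sets P" for i j
  proof -
    have comp: "(\<lambda>a. a q) \<in> measurable P M" for q
      unfolding P_def by measurable
    have "(\<lambda>a. cnj (g i (a q)) * g j (a q)) \<in> borel_measurable P" for q
      by (intro borel_measurable_times measurable_compose[OF comp g_meas] measurable_compose[OF comp cnj_meas])
    then show ?thesis unfolding B2_def by measurable
  qed
  have p1: "measure P B1 \<le> ?m * exp (- \<Lambda>)"
  proof -
    have "measure P B1 \<le> ?m * (3 / 2 * s * ?n * real R / (?n / 4)\<^sup>2) ^ R"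
      unfolding B1_def P_def
      by (rule prob_trace_large) (use s n0 R4 in auto)
    also have "\<dots> \<le> ?m * exp (- \<Lambda>)"
    proof (intro mult_left_mono power_le_exp)
      have "3 / 2 * s * ?n * real R / (?n / 4)\<^sup>2 = 24 * (real R * s) / ?n"
        using n0 by (simp add: power2_eq_square field_simps)
      also have "\<dots> \<le> 1 / 3" using R24 n0 by (simp add: pos_divide_le_eq)
      finally show "3 / 2 * s * ?n * real R / (?n / 4)\<^sup>2 \<le> 1 / 3" .
    qed (use s R in auto)
    finally show ?thesis .
  qed
  have p2: "measure P (B2 i j) \<le> exp (- 2 * \<Lambda>)" if "i \<noteq> j" for i j
  proof -
    have "measure P (B2 i j) \<le> (real r * (\<Sum>q\<in>(UNIV :: 'n set). (norm (1::complex))\<^sup>2) / t\<^sup>2) ^ r"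
      unfolding B2_def P_def by (rule steinhaus.steinhaus_tail[OF steinhaus_cross[OF that]]) (use t in auto)
    also have "\<dots> = (real r / (8 * \<Lambda>)) ^ r" using n0 by (simp add: t)
    also have "\<dots> \<le> exp (- (2 * \<Lambda>))"
      using r \<Lambda> by (intro power_le_exp) (auto simp: field_simps)
    finally show ?thesis by simp
  qed
  define I where "I = {z :: 'm \<times> 'm. fst z \<noteq> snd z}"
  define bad where "bad = B1 \<union> (\<Union>z\<in>I. B2 (fst z) (snd z))"
  have badm: "bad \<in> sets P" unfolding bad_def using B1m B2m by (intro sets.Un sets.finite_UN) auto
  have "measure P (\<Union>z\<in>I. B2 (fst z) (snd z)) \<le> (\<Sum>z\<in>I. measure P (B2 (fst z) (snd z)))"
    by (rule P.finite_measure_subadditive_finite) (use B2m in auto)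
  also have "\<dots> \<le> (\<Sum>z\<in>I. exp (- 2 * \<Lambda>))"
    by (rule sum_mono) (use p2 in \<open>auto simp: I_def\<close>)
  also have "\<dots> \<le> ?m\<^sup>2 * exp (- 2 * \<Lambda>)"
  proof -
    have "card I \<le> card (UNIV :: ('m \<times> 'm) set)" by (rule card_mono) auto
    then have "card I \<le> CARD('m) * CARD('m)" by (simp only: UNIV_Times_UNIV[symmetric] card_cartesian_product)
    then have "real (card I) \<le> ?m\<^sup>2" unfolding power2_eq_square by (metis of_nat_le_iff of_nat_mult)
    then show ?thesis by (simp add: mult_right_mono)
  qed
  finally have "measure P bad \<le> ?m * exp (- \<Lambda>) + ?m\<^sup>2 * exp (- 2 * \<Lambda>)"
    unfolding bad_def using p1 measure_Un_le[of B1 P "\<Union>z\<in>I. B2 (fst z) (snd z)"]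
      B1m sets.finite_UN[of I "\<lambda>z. B2 (fst z) (snd z)" P] B2m by simp
  then have good1: "1 - ?m\<^sup>2 * exp (- 2 * \<Lambda>) - ?m * exp (- \<Lambda>) \<le> measure P (space P - bad)"
    using badm by (simp add: P.prob_compl)
  have good2: "(norm (gram a $ i $ j))\<^sup>2 \<le> 8 * \<Lambda> / ?n" if "a \<in> space P - bad" "i \<noteq> j" for a i j
  proof -
    let ?z = "\<Sum>q\<in>UNIV. cnj (g i (a q)) * g j (a q)"
    have "norm ?z < t" using that by (auto simp: bad_def I_def B2_def not_le)
    then have "(norm ?z)\<^sup>2 \<le> t\<^sup>2" by (intro power_mono) auto
    have "(norm (gram a $ i $ j))\<^sup>2 = (norm ?z)\<^sup>2 / ?n\<^sup>2"
      by (simp add: gram_def norm_divide power_divide)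
    also have "\<dots> \<le> 8 * \<Lambda> * ?n / ?n\<^sup>2"
      using \<open>(norm ?z)\<^sup>2 \<le> t\<^sup>2\<close> unfolding t by (rule divide_right_mono) simp
    finally show ?thesis by (simp add: power2_eq_square)
  qed
  have good3: "norm ((coord_proj S ** gram a ** coord_proj S - coord_proj S) *v x) \<le> 1 / 4 * norm x"
    if "a \<in> space P - bad" for a x
  proof -
    have "rtr (mpow (dev_sum a) (2 * R)) \<le> (?n / 4) ^ (2 * R)"
      using that by (auto simp: bad_def B1_def)
    then have "norm (dev_sum a *v x) \<le> ?n / 4 * norm x"
      using R by (intro norm_hermitian_le[OF hermitian_dev_sum]) auto
    moreover have "((1 / ?n) *\<^sub>R dev_sum a) *v x = (1 / ?n) *\<^sub>R (dev_sum a *v x)"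
      by (simp only: vec_eq_iff matrix_vector_mult_def vec_lambda_beta vector_scaleR_component
          scaleR_sum_right mult_scaleR_left) simp
    ultimately show ?thesis
      unfolding compressed_gram using n0 by (simp add: field_simps)
  qed
  show ?thesis using that[of "space P - bad"] badm good1 good2 good3 by auto
qed

end

section \<open>The synthetic aperture matrix as a phase system\<close>

definition SA_phase :: "real \<Rightarrow> real \<Rightarrow> ('m \<Rightarrow> real \<times> real) \<Rightarrow> 'm \<Rightarrow> real \<times> real \<Rightarrow> complex" where
  "SA_phase lam z0 pos j u =
     cis (2 * pi / lam / z0 * ((fst (pos j) - fst u)\<^sup>2 + (snd (pos j) - snd u)\<^sup>2))"

lemma SA_matrix_phase:
  fixes pos :: "'m::finite \<Rightarrow> real \<times> real" and a :: "'n::finite \<Rightarrow> real \<times> real"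
  assumes "z0 > 0"
  shows "SA_matrix lam z0 pos a $ q $ j =
    cis (2 * (2 * pi / lam) * z0) * SA_phase lam z0 pos j (a q) / of_real (sqrt (real CARD('n)))"
  unfolding SA_matrix_nth[OF assms] exp_i_eq_cis SA_phase_def by simp

text \<open>The terms quadratic in the sensor position cancel, leaving a constant phase times a
  plane wave whose frequency is a lattice difference.\<close>

lemma SA_phase_cross:
  "cnj (SA_phase lam z0 pos i u) * SA_phase lam z0 pos j u =
    cis (2 * pi / lam / z0 * ((fst (pos j))\<^sup>2 - (fst (pos i))\<^sup>2 + ((snd (pos j))\<^sup>2 - (snd (pos i))\<^sup>2))) *
    cis (2 * (2 * pi / lam / z0) * ((fst (pos i) - fst (pos j)) * fst u + (snd (pos i) - snd (pos j)) * snd u))"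
  by (simp add: SA_phase_def cis_cnj cis_mult) (simp add: power2_eq_square algebra_simps add_divide_distrib diff_divide_distrib)

lemma square_lattice_diff:
  assumes bij: "bij_betw pos UNIV (square_lattice x0 y0 l k)" and ij: "i \<noteq> j"
  obtains a b :: int where "a \<noteq> 0 \<or> b \<noteq> 0"
    "fst (pos i) - fst (pos j) = l * of_int a" "snd (pos i) - snd (pos j) = l * of_int b"
proof -
  have "pos i \<in> square_lattice x0 y0 l k" "pos j \<in> square_lattice x0 y0 l k"
    using bij by (auto simp: bij_betw_def)
  then obtain a b a' b' where p: "pos i = (x0 + l * real a, y0 + l * real b)" "pos j = (x0 + l * real a', y0 + l * real b')"
    by (auto simp: square_lattice_def)
  have "pos i \<noteq> pos j" using bij ij by (meson bij_betw_def injD)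
  then have "int a - int a' \<noteq> 0 \<or> int b - int b' \<noteq> 0" using p by auto
  then show ?thesis
    by (rule that) (simp_all add: p right_diff_distrib)
qed

definition sensor_law :: "real \<Rightarrow> (real \<times> real) measure" where
  "sensor_law A = uniform_measure lborel ({0..A} \<times> {0..A})"

lemma prob_space_sensor_law: "A > 0 \<Longrightarrow> prob_space (sensor_law A)"
  unfolding sensor_law_def
proof (rule prob_space_uniform_measure)
  assume "A > 0"
  then have "emeasure lborel ({0..A} \<times> {0..A}) = ennreal (A * A)"
    unfolding lborel_prod[symmetric] by (subst lborel.emeasure_pair_measure_Times) (simp_all add: ennreal_mult)
  with \<open>A > 0\<close> show "emeasure lborel ({0..A} \<times> {0..A}) \<noteq> 0" "emeasure lborel ({0..A} \<times> {0..A}) \<noteq> \<infinity>"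
    by simp_all
qed

lemma SA_phase_measurable: "SA_phase lam z0 pos j \<in> borel_measurable (sensor_law A)"
proof -
  have "SA_phase lam z0 pos j \<in> borel_measurable borel"
    unfolding SA_phase_def[abs_def] cis_conv_exp by (intro borel_measurable_continuous_onI continuous_intros)
  then show ?thesis by (simp add: sensor_law_def)
qed

text \<open>A lattice step changes the frequency by \<open>2 * pi / A\<close> times
  \<open>2 / rho\<close>. Since \<open>2 / rho\<close> is a positive integer, distinct targets give
  nontrivial characters of the square of side \<open>A\<close>, and so do all their powers.\<close>

lemma SA_phase_system:
  fixes pos :: "'m::finite \<Rightarrow> real \<times> real"
  assumes pos: "z0 > 0" "l > 0" "A > 0" "lam > 0"
    and bij: "bij_betw pos UNIV (square_lattice x0 y0 l k)"
    and rho: "rho = lam * z0 / (l * A)" "2 / rho \<in> \<nat>"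
  shows "phase_system (sensor_law A) (SA_phase lam z0 pos)"
proof -
  interpret prob_space "sensor_law A" by (rule prob_space_sensor_law) fact
  show ?thesis
  proof
    show "SA_phase lam z0 pos j \<in> borel_measurable (sensor_law A)" for j by (rule SA_phase_measurable)
    show "norm (SA_phase lam z0 pos j w) = 1" for j w by (simp add: SA_phase_def)
    fix i j :: 'm and r :: nat assume ij: "i \<noteq> j" and r: "r \<ge> 1"
    obtain a b where ab: "a \<noteq> 0 \<or> b \<noteq> 0"
      "fst (pos i) - fst (pos j) = l * of_int a" "snd (pos i) - snd (pos j) = l * of_int b"
      using square_lattice_diff[OF bij ij] by blast
    obtain N where N: "2 / rho = real N" using rho(2) by (auto elim: Nats_cases)
    have "rho > 0" using rho(1) pos by simp
    then have N0: "N > 0" using N by (cases N) auto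
    have w: "2 * (2 * pi / lam / z0) * l = 2 * pi * real N / A"
      using N[symmetric] rho(1) pos by (simp add: field_simps)
    define c0 where "c0 = 2 * pi / lam / z0 * ((fst (pos j))\<^sup>2 - (fst (pos i))\<^sup>2 + ((snd (pos j))\<^sup>2 - (snd (pos i))\<^sup>2))"
    have "(cnj (SA_phase lam z0 pos i u) * SA_phase lam z0 pos j u) ^ r =
        cis (real r * c0) * cis (2 * pi * (of_int (int (r * N) * a) * fst u + of_int (int (r * N) * b) * snd u) / A)" for u
    proof -
      have "2 * (2 * pi / lam / z0) * ((fst (pos i) - fst (pos j)) * fst u + (snd (pos i) - snd (pos j)) * snd u)
          = 2 * (2 * pi / lam / z0) * l * (of_int a * fst u + of_int b * snd u)"
      proof -
        have "c * (l * of_int a * x + l * of_int b * y) = c * l * (of_int a * x + of_int b * y)" for c x y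
          by (simp add: algebra_simps)
        then show ?thesis unfolding ab .
      qed
      also have "\<dots> = 2 * pi * real N / A * (of_int a * fst u + of_int b * snd u)" unfolding w ..
      finally show ?thesis
        unfolding SA_phase_cross c0_def[symmetric] power_mult_distrib Complex.DeMoivre
        by (simp add: algebra_simps add_divide_distrib)
    qed
    moreover have "expectation (\<lambda>u. cis (2 * pi * (of_int (int (r * N) * a) * fst u + of_int (int (r * N) * b) * snd u) / A)) = 0"
      unfolding sensor_law_def using ab(1) N0 r by (intro uniform_square_cis pos) auto
    ultimately show "expectation (\<lambda>u. (cnj (SA_phase lam z0 pos i u) * SA_phase lam z0 pos j u) ^ r) = 0"
      by simp
  qed
qed

lemma SA_matrix_gram:
  fixes pos :: "'m::finite \<Rightarrow> real \<times> real" and a :: "'n::finite \<Rightarrow> real \<times> real"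
  assumes "z0 > 0" and ps: "phase_system M (SA_phase lam z0 pos)"
  shows "hadj (SA_matrix lam z0 pos a) ** SA_matrix lam z0 pos a = phase_system.gram (SA_phase lam z0 pos) a"
proof -
  let ?B = "SA_matrix lam z0 pos a"
  have "cnj (?B $ q $ i) * ?B $ q $ j
      = cnj (SA_phase lam z0 pos i (a q)) * SA_phase lam z0 pos j (a q) / of_nat CARD('n)" for q i j
  proof -
    have "complex_of_real (sqrt (real CARD('n))) * complex_of_real (sqrt (real CARD('n))) = of_nat CARD('n)"
      by (simp flip: of_real_mult)
    moreover have "cnj (cis t) * cis t = 1" for t by (simp add: cis_cnj cis_mult)
    ultimately show ?thesis
      unfolding SA_matrix_phase[OF assms(1)] by (simp add: mult_ac)
  qed
  then show ?thesis
    by (simp add: vec_eq_iff matrix_matrix_mult_def hadj_def phase_system.gram_def[OF ps] sum_divide_distrib)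
qed

lemma SA_matrix_measurable:
  "SA_matrix lam z0 pos \<in> borel_measurable (sensor_ensemble A :: ('n::finite \<Rightarrow> real \<times> real) measure)"
  if "z0 > 0" for pos :: "'m::finite \<Rightarrow> real \<times> real"
proof -
  have "(\<lambda>a. SA_matrix lam z0 pos a $ q $ j) \<in> borel_measurable (sensor_ensemble A :: ('n \<Rightarrow> real \<times> real) measure)" for q j
  proof -
    have "(\<lambda>a. a q) \<in> measurable (sensor_ensemble A :: ('n \<Rightarrow> real \<times> real) measure) (sensor_law A)"
      unfolding sensor_ensemble_def sensor_law_def by measurable
    from measurable_compose[OF this SA_phase_measurable] show ?thesis
      unfolding SA_matrix_phase[OF that] by (intro borel_measurable_divide borel_measurable_times) auto
  qed
  then show ?thesis
    unfolding borel_measurable_euclidean_space[where f = "SA_matrix lam z0 pos"]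
    by (auto simp: Basis_vec_def inner_axis intro!: borel_measurable_inner)
qed

section \<open>Combining sensors and targets\<close>

lemma sum_support_law: "(\<Sum>S | card S \<le> s. pmf (support_law s :: 'm::finite set pmf) S) = 1" for s :: nat
proof (rule sum_pmf_eq_1)
  show "set_pmf (support_law s) \<subseteq> {S :: 'm::finite set. card S \<le> s}"
    unfolding support_law_def by (auto simp: set_replicate_pmf card_length)
qed simp

text \<open>Each bracket is truncated at 0, because two negative brackets would have a positive
  product. The proof bounds the right-hand side by \<open>(1 - delta) * (1 - eps)\<close> whenever
  it is positive.\<close>

theorem theorem8:
  fixes z0 l A lam rho x0 y0 delta K eps p :: real
    and n m k s :: nat
    and pos :: "'m::finite \<Rightarrow> real \<times> real"
    and T :: "(complex ^ 'm) measure"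
  assumes "z0 > 0" "l > 0" "A > 0" "lam > 0"
    and "n = CARD('n::finite)" "m = CARD('m)"
    and "m = k\<^sup>2"
    and "bij_betw pos UNIV (square_lattice x0 y0 l k)"
    and "rho = lam * z0 / (l * A)"
    and "2 / rho \<in> \<nat>"
    and "s \<ge> 2"
    and "target_ensemble s T"
    and "0 < eps" "eps < 1"
    and "delta > 0" "K > 0"
    and "real m \<le> delta / 2 * exp (K\<^sup>2 / 2)"
    and "real s \<le> real n / (64 * ln (2 * real m / delta) * ln (real m / eps))"
    and "p = (ln (real m) - ln eps) / (288 * sqrt (exp 1) * ln (real s))"
  shows "measure ((sensor_ensemble A :: ('n \<Rightarrow> real \<times> real) measure) \<Otimes>\<^sub>M T)
           {(a, X). BP_recovers (SA_matrix lam z0 pos a) X}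
         \<ge> max 0 (1 - 2 * delta - rho * real n * (real n - 1) powr (3 / 2) / real m powr (1 / 2))
           * max 0 (1 - 2 * eps - real s powr (- p))"
    (is "?lower \<le> measure (?P \<Otimes>\<^sub>M T) ?E")
proof -
  interpret T: prob_space T using assms(12) by (simp add: target_ensemble_def)
  have sets_T: "sets T = sets borel" using assms(12) by (simp add: target_ensemble_def)
  have P_eq: "?P = Pi\<^sub>M UNIV (\<lambda>_::'n. sensor_law A)"
    by (simp add: sensor_ensemble_def sensor_law_def)
  interpret ps: phase_system "sensor_law A" "SA_phase lam z0 pos"
    by (rule SA_phase_system) fact+
  interpret pr: product_prob_space "\<lambda>_::'n. sensor_law A" UNIV by unfold_locales
  interpret P: prob_space ?P unfolding P_eq by unfold_locales
  interpret PT: pair_prob_space ?P T by unfold_locales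
  have n1: "n \<ge> 1" "m \<ge> 1" using assms(5,6) by (simp_all add: Suc_le_eq)
  have rho: "rho > 0" using assms by simp
  have upper: "?lower \<le> max 0 (1 - 2 * delta) * max 0 (1 - 2 * eps)"
  proof (intro mult_mono)
    show "max 0 (1 - 2 * delta - rho * real n * (real n - 1) powr (3 / 2) / real m powr (1 / 2)) \<le> max 0 (1 - 2 * delta)"
      using rho by (intro max.mono) auto
    show "max 0 (1 - 2 * eps - real s powr - p) \<le> max 0 (1 - 2 * eps)" by (intro max.mono) auto
  qed auto
  have E: "?E \<in> sets (?P \<Otimes>\<^sub>M T)"
  proof -
    have "(\<lambda>z. (SA_matrix lam z0 pos (fst z), snd z)) \<in> measurable (?P \<Otimes>\<^sub>M T) (borel \<Otimes>\<^sub>M borel)"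
      using measurable_compose[OF measurable_fst SA_matrix_measurable[OF assms(1)]]
        measurable_snd[of ?P T, unfolded measurable_cong_sets[OF refl sets_T]]
      by (intro measurable_Pair) auto
    moreover have "{z :: (complex ^ 'm ^ 'n) \<times> (complex ^ 'm). BP_recovers (fst z) (snd z)} \<in> sets (borel \<Otimes>\<^sub>M borel)"
      unfolding borel_prod by (rule BP_recovers_borel)
    ultimately
    have "(\<lambda>z. (SA_matrix lam z0 pos (fst z), snd z)) -` {z. BP_recovers (fst z) (snd z)} \<inter> space (?P \<Otimes>\<^sub>M T) \<in> sets (?P \<Otimes>\<^sub>M T)"
      by (rule measurable_sets)
    moreover have "space (?P \<Otimes>\<^sub>M T) = UNIV"
      using sets_eq_imp_space_eq[OF sets_T]
      by (simp add: space_pair_measure P_eq space_PiM sensor_law_def)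
    ultimately show ?thesis by (simp add: vimage_def case_prod_unfold)
  qed
  have hit_sets: "{X. support X = S \<and> BP_recovers (SA_matrix lam z0 pos a) X} \<in> sets T" for a :: "'n \<Rightarrow> real \<times> real" and S
  proof -
    have "{X. support X = S} \<in> sets T"
      using target_phase_law(1)[OF assms(12) sets.top, of S] by (simp add: space_PiM)
    moreover have "{X. support X = S \<and> BP_recovers (SA_matrix lam z0 pos a) X} = {X. support X = S} \<inter> Pair a -` ?E"
      by auto
    ultimately show ?thesis using sets_Pair1[OF E, of a] by simp
  qed
  \<comment> \<open>Outside this case a truncated bracket is 0; inside it, the bounds below 1/2 make
    the logarithms large enough.\<close>
  show ?thesis
  proof (cases "delta < 1 / 2 \<and> eps < 1 / 2")
    case False
    then have "max 0 (1 - 2 * delta) * max 0 (1 - 2 * eps) = 0" by auto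
    then show ?thesis using upper measure_nonneg[of "?P \<Otimes>\<^sub>M T" ?E] by linarith
  next
    case de: True
    have "?lower \<le> (1 - 2 * delta) * (1 - 2 * eps)" using upper de by simp
    also have "\<dots> \<le> (1 - delta) * (1 - eps)" using de assms(13,15) by (intro mult_mono) auto
    also have "(1 - delta) * (1 - eps) \<le> measure (?P \<Otimes>\<^sub>M T) ?E"
    proof (cases "m = 1")
      case True
      have "SA_matrix lam z0 pos a $ q $ j \<noteq> 0" for a :: "'n \<Rightarrow> real \<times> real" and q j
        unfolding SA_matrix_phase[OF assms(1)] SA_phase_def by simp
      then have "?E = space (?P \<Otimes>\<^sub>M T)"
        using BP_recovers_card_1 True assms(6) sets_eq_imp_space_eq[OF sets_T]
        by (fastforce simp: space_pair_measure P_eq space_PiM sensor_law_def)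
      then have "measure (?P \<Otimes>\<^sub>M T) ?E = 1" by (simp add: PT.prob_space)
      moreover have "(1 - delta) * (1 - eps) \<le> 1"
        using de assms(13,15) by (intro mult_le_one) auto
      ultimately show ?thesis by simp
    next
      case False
      then have "k \<noteq> 1" using assms(7) by auto
      moreover have "k \<noteq> 0"
      proof
        assume "k = 0"
        then show False using n1 assms(7) by simp
      qed
      ultimately have "2 \<le> k" by simp
      then have m4: "m \<ge> 4" using power_mono[of 2 k 2] assms(7) by simp
      define \<Lambda> where "\<Lambda> = ln (2 * real m / delta)"
      define L where "L = ln (real m / eps)"
      \<comment> \<open>With \<open>m \<ge> 4\<close> and both parameters below 1/2, the arguments
        of the logarithms are at least 16 and 8. The bound 3 for \<open>exp 1\<close> gives only 9
        for \<open>exp 2\<close>, hence the sharper 14/5.\<close>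
      have e8: "exp (2::real) \<le> 8" "exp (8 / 3 :: real) \<le> 16"
      proof -
        have "exp (1::real) = exp (1 / 16) ^ 16" by (simp flip: exp_of_nat_mult)
        also have "\<dots> \<le> (1 + 1 / 16 + (1 / 16)\<^sup>2) ^ 16" by (intro power_mono exp_bound) auto
        also have "\<dots> \<le> 14 / 5" by (simp add: power2_eq_square power_divide)
        finally have e: "exp (1::real) \<le> 14 / 5" .
        have "exp (2::real) = exp 1 ^ 2" by (simp flip: exp_of_nat_mult)
        also have "\<dots> \<le> (14 / 5) ^ 2" by (rule power_mono[OF e]) simp
        finally show "exp (2::real) \<le> 8" by (simp add: power2_eq_square)
        have "exp (8 / 3 :: real) ^ 3 = exp 1 ^ 8" by (simp flip: exp_of_nat_mult)
        also have "\<dots> \<le> (14 / 5) ^ 8" by (rule power_mono[OF e]) simp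
        also have "\<dots> \<le> 16 ^ 3" by (simp add: power_divide)
        finally show "exp (8 / 3 :: real) \<le> 16" by (subst (asm) power_mono_iff) auto
      qed
      have \<Lambda>: "\<Lambda> \<ge> 8 / 3"
      proof -
        have "16 \<le> 2 * real m / delta" using m4 de assms(15) by (simp add: field_simps)
        then have "exp (8 / 3) \<le> 2 * real m / delta" using e8 by linarith
        then show ?thesis unfolding \<Lambda>_def by (subst ln_ge_iff) (use m4 assms(15) in auto)
      qed
      have L: "L \<ge> 2"
      proof -
        have "8 \<le> real m / eps" using m4 de assms(13) by (simp add: field_simps)
        then have "exp 2 \<le> real m / eps" using e8 by linarith
        then show ?thesis unfolding L_def by (subst ln_ge_iff) (use m4 assms(13) in auto)
      qed
      have nLs: "64 * \<Lambda> * L * real s \<le> real CARD('n)"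
        using assms(18) \<Lambda> L unfolding \<Lambda>_def[symmetric] L_def[symmetric] assms(5)[symmetric]
        by (simp add: pos_le_divide_eq mult_ac)
      have eL: "exp (- L) = eps / real m" and e\<Lambda>: "exp (- \<Lambda>) = delta / (2 * real m)"
        using m4 assms(13,15) by (simp_all add: L_def \<Lambda>_def exp_minus)
      define r where "r = nat \<lceil>L\<rceil>"
      have r: "L \<le> real r" "real r \<le> 3 / 2 * L" using L unfolding r_def by linarith+
      \<comment> \<open>Variance bound for the dual sums:
        \<open>16 / 9 * s * (8 * \<Lambda> / n)\<close> with \<open>n\<close> at least
        \<open>64 * \<Lambda> * L * s\<close>. Since \<open>r\<close> is at most
        \<open>3 / 2 * L\<close>, the tail base \<open>r * v\<close> is at most 1/3.\<close>
      define v where "v = 2 / (9 * L)"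
      have v: "v \<ge> 0" "real r * v \<le> 1 / 3" using r L by (simp_all add: v_def field_simps)
      have tail: "real CARD('m) * (real r * v) ^ r \<le> eps"
      proof -
        have "(real r * v) ^ r \<le> exp (- L)" using v r by (intro power_le_exp) auto
        then have "real m * (real r * v) ^ r \<le> real m * exp (- L)" by (rule mult_left_mono) simp
        then show ?thesis using m4 assms(6) by (simp add: eL)
      qed
      \<comment> \<open>The sensor event may vary with \<open>S\<close>; only its probability bound
        is common to all supports.\<close>
      define Q where "Q S good \<longleftrightarrow> good \<in> sets ?P \<and> 1 - delta \<le> measure ?P good \<and>
        (\<forall>a\<in>good. pmf (support_law s) S * (1 - eps) \<le> measure T {X. support X = S \<and> BP_recovers (SA_matrix lam z0 pos a) X})"
        for S :: "'m set" and good :: "('n \<Rightarrow> real \<times> real) set"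
      have "\<exists>good. Q S good" if S: "card S \<le> s" for S
      proof -
        have s2: "real s \<ge> 2" "real (card S) \<le> real s" using S assms(11) by auto
        obtain good where good: "good \<in> sets ?P"
          "1 - (real CARD('m))\<^sup>2 * exp (- 2 * \<Lambda>) - real CARD('m) * exp (- \<Lambda>) \<le> measure ?P good"
          "\<And>a i j. a \<in> good \<Longrightarrow> i \<noteq> j \<Longrightarrow> (norm (ps.gram a $ i $ j))\<^sup>2 \<le> 8 * \<Lambda> / real CARD('n)"
          "\<And>a x. a \<in> good \<Longrightarrow> norm ((coord_proj S ** ps.gram a ** coord_proj S - coord_proj S) *v x) \<le> 1 / 4 * norm x"
          using ps.good_sensors[OF \<Lambda> L s2 nLs] unfolding P_eq by blast
        have "(real m)\<^sup>2 * exp (- 2 * \<Lambda>) + real m * exp (- \<Lambda>) \<le> delta"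
        proof -
          have "exp (- 2 * \<Lambda>) = (exp (- \<Lambda>))\<^sup>2" by (simp flip: exp_double)
          then have "(real m)\<^sup>2 * exp (- 2 * \<Lambda>) + real m * exp (- \<Lambda>) = (delta / 2)\<^sup>2 + delta / 2"
            using m4 by (simp add: e\<Lambda> power2_eq_square)
          also have "(delta / 2)\<^sup>2 \<le> delta / 2"
            unfolding power2_eq_square using de assms(15) by (intro mult_left_le) auto
          finally show ?thesis by simp
        qed
        then have pg: "1 - delta \<le> measure ?P good" using good(2) assms(6) by simp
        have "pmf (support_law s) S * (1 - eps) \<le> measure T {X. support X = S \<and> BP_recovers (SA_matrix lam z0 pos a) X}"
          if a: "a \<in> good" for a
        proof -
          let ?G = "ps.gram a"
          have gr: "hadj (SA_matrix lam z0 pos a) ** SA_matrix lam z0 pos a = ?G"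
            by (rule SA_matrix_gram[OF assms(1) ps.phase_system_axioms])
          have "\<exists>c. supported_on S c \<and> (\<forall>i\<in>S. (?G *v c) $ i = ?G $ i $ j) \<and> (\<Sum>i\<in>S. (norm (c $ i))\<^sup>2) \<le> v"
            if j: "j \<notin> S" for j
          proof -
            have coh: "(norm (?G $ i $ j))\<^sup>2 \<le> 8 * \<Lambda> / real CARD('n)" if "i \<in> S" for i
              by (rule good(3)[OF a]) (use that j in blast)
            obtain c where c: "supported_on S c" "\<And>i. i \<in> S \<Longrightarrow> (?G *v c) $ i = ?G $ i $ j"
              "(\<Sum>i\<in>S. (norm (c $ i))\<^sup>2) \<le> 16 / 9 * real (card S) * (8 * \<Lambda> / real CARD('n))"
              using dual_vector_exists[OF good(4)[OF a] coh] by blast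
            have "16 / 9 * real (card S) * (8 * \<Lambda> / real CARD('n)) \<le> 16 / 9 * real s * (8 * \<Lambda> / real CARD('n))"
              using \<Lambda> s2 by (intro mult_right_mono mult_left_mono) auto
            also have "\<dots> \<le> v"
            proof -
              have "0 < L * 9" "0 < real CARD('n)" using L by auto
              then show ?thesis using nLs by (simp add: v_def field_simps)
            qed
            finally show ?thesis using c by force
          qed
          then obtain c where c: "\<And>j. j \<notin> S \<Longrightarrow> supported_on S (c j)"
            "\<And>j i. j \<notin> S \<Longrightarrow> i \<in> S \<Longrightarrow> (?G *v c j) $ i = ?G $ i $ j"
            "\<And>j. j \<notin> S \<Longrightarrow> (\<Sum>i\<in>S. (norm (c j $ i))\<^sup>2) \<le> v"
            by metis
          let ?good = "{X. support X = S \<and> (\<forall>j. j \<notin> S \<longrightarrow> norm (\<Sum>i\<in>S. cnj (c j $ i) * sgn (X $ i)) < 1)}"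
          have "pmf (support_law s) S * (1 - eps) \<le> pmf (support_law s) S * (1 - real CARD('m) * (real r * v) ^ r)"
            using tail by (intro mult_left_mono) auto
          also have "\<dots> \<le> measure T ?good"
            by (rule target_dual_prob[OF assms(12) v(1) c(3)])
          also have "\<dots> \<le> measure T {X. support X = S \<and> BP_recovers (SA_matrix lam z0 pos a) X}"
          proof (rule T.finite_measure_mono)
            show "?good \<subseteq> {X. support X = S \<and> BP_recovers (SA_matrix lam z0 pos a) X}"
              using BP_recovers_dual[of S "SA_matrix lam z0 pos a" _ c, unfolded gr, OF good(4)[OF a] _ c(1,2)]
              by auto
          qed (rule hit_sets)
          finally show ?thesis .
        qed
        then have "Q S good" unfolding Q_def using good(1) pg by blast
        then show ?thesis ..
      qed
      then have "\<forall>S. \<exists>good. card S \<le> s \<longrightarrow> Q S good" by blast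
      from choice[OF this] obtain good where "\<And>S. card S \<le> s \<Longrightarrow> Q S (good S)" by blast
      then have good: "card S \<le> s \<Longrightarrow> good S \<in> sets ?P"
        "card S \<le> s \<Longrightarrow> 1 - delta \<le> measure ?P (good S)"
        "card S \<le> s \<Longrightarrow> a \<in> good S \<Longrightarrow> pmf (support_law s) S * (1 - eps)
          \<le> measure T {X. support X = S \<and> BP_recovers (SA_matrix lam z0 pos a) X}" for S a
        unfolding Q_def by blast+
      define hit where "hit a S = {X. support X = S \<and> BP_recovers (SA_matrix lam z0 pos a) X}" for a :: "'n \<Rightarrow> real \<times> real" and S
      let ?SS = "{S :: 'm set. card S \<le> s}"
      \<comment> \<open>The support weights sum to 1. Bounding each \<open>1 - delta\<close> by the
        probability of its own sensor event and then exchanging sum and integral handles the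
        dependence on \<open>S\<close>.\<close>
      have "ennreal ((1 - delta) * (1 - eps)) = (\<Sum>S\<in>?SS. ennreal (pmf (support_law s) S * (1 - eps)) * ennreal (1 - delta))"
      proof -
        have "(\<Sum>S\<in>?SS. pmf (support_law s) S * (1 - eps) * (1 - delta)) = (1 - delta) * (1 - eps)"
          using sum_support_law[where 'm = 'm, of s] by (simp flip: sum_distrib_right)
        then show ?thesis
          using de assms(13,15) by (simp flip: ennreal_mult)
      qed
      also have "\<dots> \<le> (\<Sum>S\<in>?SS. ennreal (pmf (support_law s) S * (1 - eps)) * emeasure ?P (good S))"
        by (intro sum_mono mult_left_mono) (use good(2) in \<open>auto simp: P.emeasure_eq_measure intro: ennreal_leI\<close>)
      also have "\<dots> = (\<integral>\<^sup>+a. (\<Sum>S\<in>?SS. ennreal (pmf (support_law s) S * (1 - eps)) * indicator (good S) a) \<partial>?P)"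
        using good(1) by (subst nn_integral_sum) (auto simp: nn_integral_cmult_indicator)
      also have "\<dots> \<le> (\<integral>\<^sup>+a. emeasure T (Pair a -` ?E) \<partial>?P)"
      proof (rule nn_integral_mono)
        fix a
        have "(\<Sum>S\<in>?SS. ennreal (pmf (support_law s) S * (1 - eps)) * indicator (good S) a)
            \<le> (\<Sum>S\<in>?SS. ennreal (measure T (hit a S)))"
          by (rule sum_mono) (use good(3) in \<open>auto simp: hit_def indicator_def intro: ennreal_leI\<close>)
        also have "\<dots> = ennreal (\<Sum>S\<in>?SS. measure T (hit a S))" by (rule sum_ennreal) auto
        \<comment> \<open>A target has only one support, so these events are disjoint and their
          probabilities add up.\<close>
        also have "(\<Sum>S\<in>?SS. measure T (hit a S)) = measure T (\<Union>S\<in>?SS. hit a S)"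
          by (rule T.finite_measure_finite_Union[symmetric])
            (auto simp: hit_def disjoint_family_on_def intro: hit_sets)
        also have "\<dots> \<le> measure T (Pair a -` ?E)"
          by (rule T.finite_measure_mono[OF _ sets_Pair1[OF E]]) (auto simp: hit_def)
        finally show "(\<Sum>S\<in>?SS. ennreal (pmf (support_law s) S * (1 - eps)) * indicator (good S) a)
            \<le> emeasure T (Pair a -` ?E)"
          unfolding T.emeasure_eq_measure by (auto intro: order_trans ennreal_leI)
      qed
      also have "\<dots> = emeasure (?P \<Otimes>\<^sub>M T) ?E" by (rule T.emeasure_pair_measure_alt[OF E, symmetric])
      finally show ?thesis unfolding PT.emeasure_eq_measure by simp
    qed
    finally show ?thesis .
  qed
qed

end
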